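(* Let $\{q_n\}$ be the Fibonacci Quilt sequence. Let the random variable $Y_n$ denote the number of summands in the Greedy-6 decomposition of an integer chosen uniformly at random from $[q_n,q_{n+1})$, and let $\mu_n$, $\sigma_n^2$ be the mean and variance of $Y_n$. Then \[\mu_n=\widetilde{A}n+\widetilde{B}+o(1),\qquad \sigma_n^2=\widetilde{C}n+\widetilde{D}+o(1)\] for some positive constants $\widetilde{A},\widetilde{B},\widetilde{C},\widetilde{D}$, and $Y_n'=(Y_n-\mu_n)/\sigma_n$ converges in distribution to the standard normal distribution as $n\to\infty$.
   Context: Given an increasing sequence of positive integers $\{q_i\}$, a decomposition $m=q_{\ell_1}+\dots+q_{\ell_t}$ with $q_{\ell_1}>\dots>q_{\ell_t}$ is FQ-legal if $|\ell_i-\ell_j|\notin\{0,1,3,4\}$ for all $i\ne j$ and $\{1,3\}\not\subset\{\ell_1,\dots,\ell_t\}$. The Fibonacci Quilt sequence has $q_1=1$ and each $q_i$ ($i\ge2$) is the smallest positive integer with no FQ-legal decomposition using $q_1,\dots,q_{i-1}$; it begins $1,2,3,4,5,7,9,12,16,21,\dots$. The Greedy-6 algorithm decomposes a positive integer $m$ as follows: if $m=q_n$ for some $n$, the decomposition is $q_n$; if $m=6$, the decomposition is $q_4+q_2$; otherwise ($m\ge q_6$ and $m$ not a term) write $m=q_{\ell_1}+x$ where $q_{\ell_1}<m<q_{\ell_1+1}$ and $x>0$, and iterate on $x$. The resulting decomposition is the Greedy-6 decomposition of $m$ (it is FQ-legal). *)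

theory Defs
  imports "HOL-Probability.Probability"
begin

text \<open>A set S of (1-based) indices is FQ-legal: pairwise index distances avoid 1,3,4
  (distance 0 is excluded since S is a set, i.e. indices are distinct) and S does not
  contain both 1 and 3.\<close>
definition FQ_legal :: "nat set \<Rightarrow> bool" where
  "FQ_legal S \<longleftrightarrow> (\<forall>i\<in>S. \<forall>j\<in>S. i \<noteq> j \<longrightarrow> nat \<bar>int i - int j\<bar> \<notin> {1, 3, 4}) \<and> \<not> ({1, 3} \<subseteq> S)"

definition FQ_next :: "nat list \<Rightarrow> nat" where
  "FQ_next xs = (if xs = [] then 1 else
     (LEAST m. 0 < m \<and> \<not> (\<exists>S. S \<subseteq> {1..length xs} \<and> FQ_legal S \<and> (\<Sum>j\<in>S. xs ! (j - 1)) = m)))"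

primrec FQ_list :: "nat \<Rightarrow> nat list" where
  "FQ_list 0 = []"
| "FQ_list (Suc n) = FQ_list n @ [FQ_next (FQ_list n)]"

text \<open>The Fibonacci Quilt sequence, 1-based: fq 1 = 1, fq 2 = 2, ...; fq 0 is a dummy.\<close>
definition fq :: "nat \<Rightarrow> nat" where
  "fq i = (if i = 0 then 0 else FQ_list i ! (i - 1))"

text \<open>Number of summands of the Greedy-6 decomposition, with a fuel argument
  (fuel m suffices, since each step strictly decreases the number).\<close>
fun greedy6_aux :: "nat \<Rightarrow> nat \<Rightarrow> nat" where
  "greedy6_aux 0 m = 0"
| "greedy6_aux (Suc k) m =
     (if m = 0 then 0
      else if (\<exists>n\<ge>1. fq n = m) then 1
      else if m = 6 then 2
      else 1 + greedy6_aux k (m - fq (THE l. 1 \<le> l \<and> fq l < m \<and> m < fq (Suc l))))"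

definition greedy6_count :: "nat \<Rightarrow> nat" where
  "greedy6_count m = greedy6_aux m m"

definition Y_dist :: "nat \<Rightarrow> real pmf" where
  "Y_dist n = map_pmf (\<lambda>m. real (greedy6_count m)) (pmf_of_set {fq n..<fq (Suc n)})"

definition Y_mean :: "nat \<Rightarrow> real" where
  "Y_mean n = measure_pmf.expectation (Y_dist n) (\<lambda>y. y)"

definition Y_var :: "nat \<Rightarrow> real" where
  "Y_var n = measure_pmf.variance (Y_dist n) (\<lambda>y. y)"

end

theory Submission
  imports Defs "HOL-Complex_Analysis.Complex_Analysis"
begin

text \<open>Let \<open>P n y\<close> be the generating polynomial of the number of Greedy-6 summands over
  \<open>[q n, q (n+1))\<close>. Since \<open>q (n+1) = q n + q (n-4)\<close>, stripping the leading summand gives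
  \<open>P (n+1) y = P n y + y P (n-4) y\<close>. Let \<open>l w\<close> be the root of \<open>l^5 - l^4 = exp w\<close> that
  continues the plastic number analytically to a neighbourhood of \<open>w = 0\<close>. The ratio
  \<open>T n w = P n (exp w) / l w ^ n\<close> satisfies a linear recurrence with a conserved quantity; this
  determines its limit as a rational function of \<open>l w\<close>, and the deviation from the limit obeys
  \<open>E n = -k (E (n-1) + ... + E (n-4))\<close> with \<open>k = 1 - 1 / l w\<close>. As \<open>4 |k| < 1\<close> near the plastic
  number, the convergence is geometric and uniform. Hence \<open>P n (exp w) = exp (n Ln (l w)) T n w\<close>
  is a quasi-power: differentiating at \<open>w = 0\<close> yields mean and variance, and a second-order Taylor
  expansion of \<open>Ln (l w)\<close> gives the convergence of the characteristic functions.\<close>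

section \<open>The Fibonacci Quilt sequence and its generating polynomials\<close>

text \<open>Recurrence that \<open>fq\<close> is shown to obey. At index 6 the general rule would
  give 5 + 1 = 6, but 6 = 4 + 2 is legal, so the term there is 7. The value at 0 matches the dummy
  \<open>fq 0\<close>.\<close>

fun quilt :: "nat \<Rightarrow> nat" where
  "quilt n = (if n \<le> 5 then n else if n = 6 then 7 else quilt (n - 1) + quilt (n - 5))"

declare quilt.simps [simp del]

lemma quilt_small [simp]:
  "quilt 0 = 0" "quilt (Suc 0) = 1" "quilt (Suc (Suc 0)) = 2" "quilt 2 = 2" "quilt 3 = 3" "quilt 4 = 4" "quilt 5 = 5"
  "quilt 6 = 7" "quilt 7 = 9" "quilt 8 = 12" "quilt 9 = 16" "quilt 10 = 21"
  by (simp_all add: quilt.simps)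

lemma quilt_Suc: "n \<ge> 6 \<Longrightarrow> quilt (Suc n) = quilt n + quilt (n - 4)"
  by (subst quilt.simps) simp

text \<open>Since x^5 - x^4 - 1 = (x^3 - x - 1) (x^2 - x + 1), the recurrence of the first factor
  can hold as well. It is checked for \<open>n\<close> from 5 to 9; afterwards the claim for
  \<open>n\<close> follows from those for \<open>n - 1\<close> and \<open>n - 5\<close>.\<close>

lemma quilt_Padovan: "n \<ge> 5 \<Longrightarrow> quilt (Suc n) = quilt (n - 1) + quilt (n - 2)"
proof (induction n rule: less_induct)
  case (less n)
  show ?case
  proof (cases "n < 10")
    case True
    with less.prems have "n = 5 \<or> n = 6 \<or> n = 7 \<or> n = 8 \<or> n = 9" by auto
    then show ?thesis by auto
  next
    case False
    define k where "k = n - 10"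
    have n: "n = k + 10" using False by (simp add: k_def)
    have "quilt (k+11) = quilt (k+10) + quilt (k+6)"
      using quilt_Suc[of "k+10"] by (simp add: eval_nat_numeral)
    moreover have "quilt (k+10) = quilt (k+8) + quilt (k+7)"
      using less.IH[of "k+9"] n by (simp add: eval_nat_numeral)
    moreover have "quilt (k+9) = quilt (k+8) + quilt (k+4)"
      using quilt_Suc[of "k+8"] by (simp add: eval_nat_numeral)
    moreover have "quilt (k+8) = quilt (k+7) + quilt (k+3)"
      using quilt_Suc[of "k+7"] by (simp add: eval_nat_numeral)
    moreover have "quilt (k+6) = quilt (k+4) + quilt (k+3)"
      using less.IH[of "k+5"] n by (simp add: eval_nat_numeral)
    ultimately show ?thesis unfolding n by (simp add: eval_nat_numeral)
  qed
qed

lemma quilt_strict_mono: "strict_mono quilt"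
proof (rule strict_mono_Suc_iff[THEN iffD2], rule allI)
  have pos: "quilt m > 0" if "m > 0" for m
    using that
  proof (induction m rule: less_induct)
    case (less m)
    then show ?case by (subst quilt.simps) auto
  qed
  fix n show "quilt n < quilt (Suc n)"
  proof (cases "n < 6")
    case True
    then have "n = 0 \<or> n = 1 \<or> n = 2 \<or> n = 3 \<or> n = 4 \<or> n = 5" by auto
    then show ?thesis by auto
  next
    case False
    then show ?thesis using quilt_Suc[of n] pos[of "n - 4"] by simp
  qed
qed

lemmas quilt_less_iff [simp] = strict_mono_less[OF quilt_strict_mono]
lemmas quilt_le_iff [simp] = strict_mono_less_eq[OF quilt_strict_mono]
lemmas quilt_eq_iff [simp] = strict_mono_eq[OF quilt_strict_mono]

lemma quilt_pos [simp]: "quilt n > 0 \<longleftrightarrow> n > 0"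
  using quilt_less_iff[of 0 n] by (simp del: quilt_less_iff)

lemma quilt_neq_6: "quilt l \<noteq> 6"
  using quilt_less_iff[of 5 l] quilt_less_iff[of l 6] by (auto simp del: quilt_less_iff)

section \<open>Legal index sets and the identification of \<open>fq\<close> with
  \<open>quilt\<close>\<close>

lemma FQ_legal_subset: "FQ_legal S \<Longrightarrow> T \<subseteq> S \<Longrightarrow> FQ_legal T"
  unfolding FQ_legal_def by blast

lemma FQ_legal_avoid:
  assumes "FQ_legal S" "i \<in> S" "j \<in> S" "j < i"
  shows "i \<noteq> j + 1" "i \<noteq> j + 3" "i \<noteq> j + 4"
proof -
  have "nat \<bar>int i - int j\<bar> \<notin> {1, 3, 4}"
    using assms unfolding FQ_legal_def by (metis less_irrefl)
  moreover have "nat \<bar>int i - int j\<bar> = i - j" using assms by auto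
  ultimately show "i \<noteq> j + 1" "i \<noteq> j + 3" "i \<noteq> j + 4" by auto
qed

text \<open>As distances 1, 3 and 4 are forbidden, a set with largest index \<open>l\<close> can
  contain only \<open>l - 2\<close> besides \<open>l\<close> and indices up to \<open>l - 5\<close>.
  The latter are bounded by induction, and q(l) + q(l-2) + q(l-1) = q(l) + q(l+1) = q(l+3) by two
  uses of the Padovan rule.\<close>

lemma sum_quilt_legal_less:
  "FQ_legal S \<Longrightarrow> S \<subseteq> {1..l} \<Longrightarrow> sum quilt S < quilt (l + 3)"
proof (induction l arbitrary: S rule: less_induct)
  case (less l)
  have fin: "finite S" using less.prems finite_subset by blast
  show ?case
  proof (cases "l \<in> S")
    case False
    show ?thesis
    proof (cases "l = 0")
      case False
      have "S \<subseteq> {1..l - 1}"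
      proof
        fix x assume "x \<in> S"
        with less.prems(2) \<open>l \<notin> S\<close> have "x \<in> {1..l}" "x \<noteq> l" by blast+
        then show "x \<in> {1..l - 1}" by auto
      qed
      then have "sum quilt S < quilt (l - 1 + 3)" using less False by (meson diff_less less_numeral_extra(1) neq0_conv)
      also have "\<dots> \<le> quilt (l + 3)" by simp
      finally show ?thesis .
    qed (use less.prems in auto)
  next
    case True
    then have l: "l \<ge> 1" using less.prems by auto
    \<comment> \<open>For \<open>l\<close> at most 2 the index \<open>l - 2\<close> truncates to 0,
      which contributes \<open>quilt 0 = 0\<close>.\<close>
    define T where "T = S - {l, l - 2}"
    have T: "T \<subseteq> {1..l - 5}"
    proof
      fix x assume x: "x \<in> T"
      then have xS: "x \<in> S" "x \<noteq> l" "x \<noteq> l - 2" by (auto simp: T_def)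
      then have "1 \<le> x" "x < l" using less.prems(2) by force+
      with FQ_legal_avoid[OF less.prems(1) True xS(1)] xS
      show "x \<in> {1..l - 5}" by auto
    qed
    have "S \<subseteq> insert l (insert (l - 2) T)" by (auto simp: T_def)
    then have "sum quilt S \<le> sum quilt (insert l (insert (l - 2) T))"
      using fin by (intro sum_mono2) (auto simp: T_def)
    also have "\<dots> \<le> quilt l + (quilt (l - 2) + sum quilt T)"
      using fin l by (auto simp: T_def sum.insert_if)
    finally have S: "sum quilt S \<le> quilt l + (quilt (l - 2) + sum quilt T)" .
    show ?thesis
    proof (cases "l < 5")
      case True
      then have "sum quilt S \<le> quilt l + quilt (l - 2)" using S T by auto
      moreover have "l = 1 \<or> l = 2 \<or> l = 3 \<or> l = 4" using True l by auto
      ultimately show ?thesis by auto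
    next
      case False
      have "FQ_legal T" using less.prems(1) by (rule FQ_legal_subset) (auto simp: T_def)
      then have "sum quilt T < quilt (l - 5 + 3)" using less.IH[of "l - 5" T] T l by auto
      \<comment> \<open>The bound q(l-2) is weakened to q(l-1) so that the Padovan rule closes the
        sum.\<close>
      also have "\<dots> \<le> quilt (l - 1)" using False by simp
      finally have "sum quilt S < quilt l + (quilt (l - 2) + quilt (l - 1))" using S by linarith
      also have "\<dots> = quilt l + quilt (l + 1)" using quilt_Padovan[of l] False by simp
      also have "\<dots> = quilt (l + 3)" using quilt_Padovan[of "l + 2"] False by (simp add: eval_nat_numeral)
      finally show ?thesis .
    qed
  qed
qed

text \<open>Turns a sum over small indices into arithmetic on membership, so that the base cases of
  the next lemma become a finite check.\<close>

lemma sum_quilt_legal_small: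
  assumes "S \<subseteq> {1..5}"
  shows "sum quilt S = (if 1 \<in> S then 1 else 0) + (if 2 \<in> S then 2 else 0)
    + (if 3 \<in> S then 3 else 0) + (if 4 \<in> S then 4 else 0) + (if 5 \<in> S then 5 else 0)"
proof -
  have "S = {1..5} \<inter> S" using assms by blast
  then have "sum quilt S = sum quilt ({1..5} \<inter> S)" by simp
  also have "\<dots> = (\<Sum>i\<in>{1..5}. if i \<in> S then quilt i else 0)"
    by (rule sum.inter_restrict) simp
  also have "{1..5::nat} = {1, 2, 3, 4, 5}" by auto
  finally show ?thesis by simp
qed

text \<open>If \<open>n\<close> is used, the other indices form a legal sum for q(n-4); if
  \<open>n - 1\<close> is used, they form one for q(n-2) by the Padovan rule; both contradict the
  induction hypothesis. Otherwise all indices are at most \<open>n - 2\<close> and the total is too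
  small by \<open>sum_quilt_legal_less\<close>.\<close>

lemma quilt_not_legal_sum:
  "n \<ge> 1 \<Longrightarrow> FQ_legal S \<Longrightarrow> S \<subseteq> {1..n} \<Longrightarrow> sum quilt S \<noteq> quilt (Suc n)"
proof (induction n arbitrary: S rule: less_induct)
  case (less n)
  have fin: "finite S" using less.prems finite_subset by blast
  note avoid = FQ_legal_avoid[OF less.prems(2)]
  show ?case
  proof (cases "n < 6")
    case True
    have sub: "S \<subseteq> {1..5}" using less.prems(3) True by auto
    have "\<not> (1 \<in> S \<and> 2 \<in> S)" "\<not> (2 \<in> S \<and> 3 \<in> S)" "\<not> (3 \<in> S \<and> 4 \<in> S)" "\<not> (4 \<in> S \<and> 5 \<in> S)"
      "\<not> (1 \<in> S \<and> 4 \<in> S)" "\<not> (2 \<in> S \<and> 5 \<in> S)" "\<not> (1 \<in> S \<and> 5 \<in> S)"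
      using avoid[of 2 1] avoid[of 3 2] avoid[of 4 3] avoid[of 5 4] avoid[of 4 1] avoid[of 5 2] avoid[of 5 1]
      by auto
    moreover have "\<not> (1 \<in> S \<and> 3 \<in> S)" using less.prems(2) by (simp add: FQ_legal_def)
    moreover have "\<And>i. i > n \<Longrightarrow> i \<notin> S" using less.prems(3) by auto
    moreover have "n = 1 \<or> n = 2 \<or> n = 3 \<or> n = 4 \<or> n = 5" using True less.prems(1) by auto
    ultimately show ?thesis using sum_quilt_legal_small[OF sub]
      by (auto split: if_splits)
  next
    case n6: False
    show ?thesis
    proof
      assume eq: "sum quilt S = quilt (Suc n)"
      consider "n \<in> S" | "n \<notin> S" "n - 1 \<in> S" | "n \<notin> S" "n - 1 \<notin> S" by blast
      then show False
      proof cases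
        case 1
        have s: "sum quilt (S - {n}) = quilt (n - 4)"
          using eq quilt_Suc[of n] n6 sum.remove[OF fin 1, of quilt] by simp
        \<comment> \<open>Distance 2 is legal, so \<open>n - 2\<close> has to be excluded by size:
          its term exceeds the remaining sum q(n-4).\<close>
        have "n - 2 \<notin> S"
        proof
          assume "n - 2 \<in> S"
          then have "quilt (n - 2) \<le> sum quilt (S - {n})"
            using fin n6 by (intro member_le_sum) auto
          with s n6 show False by simp
        qed
        have "S - {n} \<subseteq> {1..n - 5}"
        proof
          fix x assume "x \<in> S - {n}"
          moreover from this have "1 \<le> x" "x < n" using less.prems(3) by force+
          moreover have "x \<noteq> n - 2" using \<open>n - 2 \<notin> S\<close> calculation by auto
          ultimately show "x \<in> {1..n - 5}" using avoid[OF 1, of x] by auto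
        qed
        moreover have "FQ_legal (S - {n})" using less.prems(2) by (rule FQ_legal_subset) auto
        moreover have "1 \<le> n - 5" "n - 5 < n" "Suc (n - 5) = n - 4" using n6 by linarith+
        ultimately show False using less.IH[of "n - 5" "S - {n}"] s by metis
      next
        case 2
        have s: "sum quilt (S - {n - 1}) = quilt (n - 2)"
          using eq quilt_Padovan[of n] n6 sum.remove[OF fin 2(2), of quilt] by simp
        have "S - {n - 1} \<subseteq> {1..n - 3}"
        proof
          fix x assume x: "x \<in> S - {n - 1}"
          moreover from this have "1 \<le> x" "x \<le> n" using less.prems(3) by auto
          moreover have "x \<noteq> n" using x 2 by auto
          ultimately have "x < n - 1" by auto
          with x \<open>1 \<le> x\<close> show "x \<in> {1..n - 3}" using avoid[OF 2(2), of x] by auto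
        qed
        moreover have "FQ_legal (S - {n - 1})" using less.prems(2) by (rule FQ_legal_subset) auto
        moreover have "1 \<le> n - 3" "n - 3 < n" "Suc (n - 3) = n - 2" using n6 by linarith+
        ultimately show False using less.IH[of "n - 3" "S - {n - 1}"] s by metis
      next
        case 3
        have "S \<subseteq> {1..n - 2}"
        proof
          fix x assume x: "x \<in> S"
          then have "1 \<le> x" "x \<le> n" using less.prems(3) by auto
          moreover have "x \<noteq> n" "x \<noteq> n - 1" using x 3 by auto
          ultimately show "x \<in> {1..n - 2}" by auto
        qed
        then have "sum quilt S < quilt (n - 2 + 3)"
          by (rule sum_quilt_legal_less[OF less.prems(2)])
        also have "n - 2 + 3 = Suc n" using n6 by auto
        finally show False using eq by simp
      qed
    qed
  qed
qed

text \<open>Greedy choice: after q(n) is removed the remainder is below q(n-4), so it uses indices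
  up to \<open>n - 5\<close>, all at distance at least 5 from \<open>n\<close>. The exception is 6 =
  q(2) + q(4), which lies between q(5) and q(6).\<close>

lemma exists_legal_sum:
  "m < quilt (Suc n) \<Longrightarrow> \<exists>S. S \<subseteq> {1..n} \<and> FQ_legal S \<and> sum quilt S = m"
proof (induction n arbitrary: m rule: less_induct)
  case (less n)
  show ?case
  proof (cases "m < quilt n")
    case True
    then have "n \<ge> 1" by (cases n) auto
    then obtain S where "S \<subseteq> {1..n - 1}" "FQ_legal S" "sum quilt S = m"
      using less.IH[of "n - 1" m] True by auto
    then show ?thesis by (intro exI[of _ S]) force
  next
    case ge: False
    consider "m = quilt n" "n = 0" | "m = quilt n" "n > 0" | "m > quilt n" "n \<le> 5" | "m > quilt n" "n \<ge> 6"
      using ge by linarith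
    then show ?thesis
    proof cases
      case 1
      then show ?thesis by (intro exI[of _ "{}"]) (auto simp: FQ_legal_def)
    next
      case 2
      then show ?thesis by (intro exI[of _ "{n}"]) (auto simp: FQ_legal_def)
    next
      case 3
      then have "n = 0 \<or> n = 1 \<or> n = 2 \<or> n = 3 \<or> n = 4 \<or> n = 5" by auto
      with 3 less.prems have "n = 5" "m = 6" by auto
      then show ?thesis by (intro exI[of _ "{2, 4}"]) (auto simp: FQ_legal_def)
    next
      case 4
      then have "Suc (n - 5) = n - 4" by linarith
      then have "m - quilt n < quilt (Suc (n - 5))"
        using 4 less.prems quilt_Suc[of n] by simp
      then obtain S where S: "S \<subseteq> {1..n - 5}" "FQ_legal S" "sum quilt S = m - quilt n"
        using less.IH[of "n - 5"] 4 by auto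
      have "FQ_legal (insert n S)"
        using S(1,2) 4(2) unfolding FQ_legal_def by fastforce
      moreover have "sum quilt (insert n S) = m"
        using S 4 finite_subset[OF S(1)] by (subst sum.insert) auto
      moreover have "{1..n - 5} \<subseteq> {1..n}" "n \<in> {1..n}" using 4(2) by auto
      then have "insert n S \<subseteq> {1..n}" using S(1) by blast
      ultimately show ?thesis by blast
    qed
  qed
qed

text \<open>\<open>quilt_not_legal_sum\<close> shows that the claimed value is admissible and
  \<open>exists_legal_sum\<close> that nothing smaller is. For \<open>n = 0\<close> the empty-list
  clause applies.\<close>

lemma FQ_next_quilt: "FQ_next (map quilt [1..<Suc n]) = quilt (Suc n)"
proof (cases "n = 0")
  case False
  \<comment> \<open>\<open>FQ_next\<close> reads a zero-based list at \<open>j - 1\<close>, which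
    holds the term with one-based index \<open>j\<close>.\<close>
  have nth: "(\<Sum>j\<in>S. map quilt [1..<Suc n] ! (j - 1)) = sum quilt S" if "S \<subseteq> {1..n}" for S
  proof (rule sum.cong)
    fix j assume "j \<in> S"
    then have "1 \<le> j" "j \<le> n" using that by auto
    then show "map quilt [1..<Suc n] ! (j - 1) = quilt j" by (simp del: upt_Suc)
  qed simp
  have "FQ_next (map quilt [1..<Suc n]) =
      (LEAST m. 0 < m \<and> \<not> (\<exists>S. S \<subseteq> {1..n} \<and> FQ_legal S \<and> sum quilt S = m))"
    using False nth unfolding FQ_next_def by (auto simp del: upt_Suc cong: conj_cong)
  also have "\<dots> = quilt (Suc n)"
  proof (rule Least_equality)
    show "0 < quilt (Suc n) \<and> \<not> (\<exists>S. S \<subseteq> {1..n} \<and> FQ_legal S \<and> sum quilt S = quilt (Suc n))"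
      using quilt_not_legal_sum[of n] False by auto
  next
    fix m assume "0 < m \<and> \<not> (\<exists>S. S \<subseteq> {1..n} \<and> FQ_legal S \<and> sum quilt S = m)"
    then show "quilt (Suc n) \<le> m" using exists_legal_sum[of m n] by (meson not_le)
  qed
  finally show ?thesis .
qed (simp add: FQ_next_def)

lemma fq_eq_quilt: "fq = quilt"
proof
  have list: "FQ_list n = map quilt [1..<Suc n]" for n
    by (induction n) (use FQ_next_quilt in simp_all)
  show "fq n = quilt n" for n
    by (cases n) (simp_all add: fq_def list del: upt_Suc)
qed

section \<open>Counting the Greedy-6 summands\<close>

lemma quilt_bracket:
  assumes "m \<ge> 1"
  obtains n where "n \<ge> 1" "quilt n \<le> m" "m < quilt (Suc n)"
proof -
  have "k \<le> quilt k" for k using quilt_strict_mono by (rule strict_mono_imp_increasing)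
  then have "m < quilt (Suc m)" using Suc_le_lessD by blast
  then have "\<exists>n. m < quilt n" by blast
  define n where "n = (LEAST n. m < quilt n)"
  have 1: "m < quilt n" unfolding n_def using \<open>\<exists>n. m < quilt n\<close> by (rule LeastI_ex)
  have 2: "n > 1" using 1 assms by (cases "n = 0 \<or> n = 1") auto
  have "\<not> m < quilt (n - 1)"
    using not_less_Least[of "n - 1" "\<lambda>n. m < quilt n"] 2 unfolding n_def by simp
  with 1 2 show ?thesis by (intro that[of "n - 1"]) auto
qed

lemma greedy6_aux_quilt: "n \<ge> 1 \<Longrightarrow> greedy6_aux (Suc k) (quilt n) = 1"
  by (auto simp: fq_eq_quilt)

text \<open>The bound on \<open>x\<close> puts the number strictly between two consecutive terms, so
  the description by \<open>THE\<close> is uniquely \<open>n\<close>; it also exceeds 7, so the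
  clause for 6 does not apply.\<close>

lemma greedy6_aux_quilt_add:
  assumes "n \<ge> 6" "0 < x" "x < quilt (n - 4)"
  shows "greedy6_aux (Suc k) (quilt n + x) = Suc (greedy6_aux k x)"
proof -
  have up: "quilt n + x < quilt (Suc n)" using quilt_Suc assms by simp
  have unique: "l = n" if "quilt l < quilt n + x" "quilt n + x < quilt (Suc l)" for l
  proof -
    have "quilt l < quilt (Suc n)" "quilt n < quilt (Suc l)" using that up by linarith+
    then show ?thesis by simp
  qed
  have "\<nexists>l. l \<ge> 1 \<and> quilt l = quilt n + x"
  proof
    assume "\<exists>l. l \<ge> 1 \<and> quilt l = quilt n + x"
    then obtain l where "quilt l = quilt n + x" by blast
    with up assms(2) have "quilt n < quilt l" "quilt l < quilt (Suc n)" by linarith+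
    then show False by simp
  qed
  moreover have "(THE l. 1 \<le> l \<and> quilt l < quilt n + x \<and> quilt n + x < quilt (Suc l)) = n"
    using assms up unique by (intro the_equality) auto
  moreover have "quilt n + x \<noteq> 6" using assms quilt_le_iff[of 6 n] by (simp del: quilt_le_iff)
  ultimately show ?thesis using assms by (auto simp: fq_eq_quilt)
qed

text \<open>Each recursive call receives a strictly smaller number, so fuel \<open>m\<close> is
  enough and any surplus is harmless.\<close>

lemma greedy6_aux_fuel: "m \<le> k \<Longrightarrow> greedy6_aux k m = greedy6_count m"
proof (induction m arbitrary: k rule: less_induct)
  case (less m)
  show ?case
  proof (cases "m = 0")
    case True
    then show ?thesis by (cases k) (simp_all add: greedy6_count_def)
  next
    case False
    then obtain k' m' where km: "k = Suc k'" "m = Suc m'" using less.prems by (metis Suc_le_D not0_implies_Suc)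
    obtain n where n: "n \<ge> 1" "quilt n \<le> m" "m < quilt (Suc n)" using quilt_bracket False
      by (metis One_nat_def Suc_leI neq0_conv)
    consider "m = quilt n" | "quilt n < m" "n \<ge> 6" | "quilt n < m" "n < 6" using n by linarith
    then show ?thesis
    proof cases
      case 1
      then show ?thesis unfolding greedy6_count_def using greedy6_aux_quilt n(1) km by metis
    next
      case 2
      define x where "x = m - quilt n"
      have x: "m = quilt n + x" "0 < x" "x < quilt (n - 4)" "x < m"
        using 2 n(3) quilt_Suc[OF 2(2)] by (auto simp: x_def)
      have "greedy6_aux k m = Suc (greedy6_aux k' x)"
        using greedy6_aux_quilt_add[OF 2(2) x(2,3)] km(1) x(1) by simp
      moreover have "greedy6_count m = Suc (greedy6_aux m' x)"
        using greedy6_aux_quilt_add[OF 2(2) x(2,3), of m'] km(2) x(1) unfolding greedy6_count_def by metis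
      moreover have "greedy6_aux k' x = greedy6_aux m' x"
        using less.IH[of x] x less.prems km by (metis Suc_leI Suc_le_mono le_trans)
      ultimately show ?thesis by simp
    next
      case 3
      \<comment> \<open>Among the numbers below q(6) = 7, only 6 lies strictly between two terms; it
        has its own clause.\<close>
      with n(1) have "n = 1 \<or> n = 2 \<or> n = 3 \<or> n = 4 \<or> n = 5" by auto
      with 3 n have "m = 6" by auto
      moreover have "\<nexists>l. l \<ge> 1 \<and> quilt l = 6" using quilt_neq_6 by blast
      ultimately show ?thesis using km(1)
        by (auto simp: greedy6_count_def fq_eq_quilt numeral_eq_Suc)
    qed
  qed
qed

lemma greedy6_count_0 [simp]: "greedy6_count 0 = 0"
  by (simp add: greedy6_count_def)

lemma greedy6_count_quilt [simp]: "n \<ge> 1 \<Longrightarrow> greedy6_count (quilt n) = 1"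
  using greedy6_aux_quilt[of n "quilt n - 1"] quilt_pos[of n] by (simp add: greedy6_count_def)

lemma greedy6_count_6: "greedy6_count 6 = 2"
proof -
  have "greedy6_count 6 = greedy6_aux (Suc 5) 6"
    by (simp add: greedy6_count_def)
  then show ?thesis
    unfolding greedy6_aux.simps using quilt_neq_6 by (auto simp: fq_eq_quilt)
qed

text \<open>Because 0 counts as having no summands, \<open>x = 0\<close> is included, and the rule
  holds on the whole interval [0, q(n-4)).\<close>

lemma greedy6_count_quilt_add:
  assumes "n \<ge> 6" "x < quilt (n - 4)"
  shows "greedy6_count (quilt n + x) = Suc (greedy6_count x)"
proof (cases "x = 0")
  case False
  obtain k where k: "quilt n + x = Suc k" using False by (cases "quilt n + x") auto
  have "quilt n > 0" using assms by simp
  then have "x \<le> k" using k by linarith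
  have "greedy6_count (quilt n + x) = greedy6_aux (Suc k) (quilt n + x)"
    using k by (simp only: greedy6_count_def)
  also have "\<dots> = Suc (greedy6_aux k x)"
    using greedy6_aux_quilt_add assms False by simp
  also have "greedy6_aux k x = greedy6_count x" using \<open>x \<le> k\<close> by (rule greedy6_aux_fuel)
  finally show ?thesis .
qed (use assms in simp)

section \<open>The generating polynomials and their recurrence\<close>

definition summand_poly :: "nat \<Rightarrow> 'a::comm_semiring_1 \<Rightarrow> 'a" where
  "summand_poly n y = (\<Sum>m\<in>{fq n..<fq (Suc n)}. y ^ greedy6_count m)"

text \<open>The interval [q(n), q(n+1)) is [0, q(n-4)) shifted by q(n), and the shift adds exactly
  one summand.\<close>

lemma summand_poly_unfold:
  assumes "n \<ge> 6"
  shows "summand_poly n y = y * (\<Sum>x<quilt (n - 4). y ^ greedy6_count x)"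
proof -
  have "summand_poly n y = (\<Sum>m\<in>{0 + quilt n..<quilt (n - 4) + quilt n}. y ^ greedy6_count m)"
    using quilt_Suc[OF assms] by (simp add: summand_poly_def fq_eq_quilt add.commute)
  also have "\<dots> = (\<Sum>x\<in>{0..<quilt (n - 4)}. y ^ greedy6_count (x + quilt n))"
    by (rule sum.shift_bounds_nat_ivl)
  also have "\<dots> = (\<Sum>x\<in>{0..<quilt (n - 4)}. y * y ^ greedy6_count x)"
    using greedy6_count_quilt_add[OF assms] by (intro sum.cong) (auto simp: add.commute)
  finally show ?thesis by (simp add: sum_distrib_left atLeast0LessThan)
qed

text \<open>From \<open>n\<close> to \<open>Suc n\<close> the range of remainders grows from [0,
  q(n-4)) to [0, q(n-3)); the added piece is the interval that \<open>summand_poly (n - 4)\<close>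
  counts.\<close>

lemma summand_poly_Suc:
  assumes "n \<ge> 6"
  shows "summand_poly (Suc n) y = summand_poly n y + y * summand_poly (n - 4) y"
proof -
  let ?f = "\<lambda>x. y ^ greedy6_count x"
  have n: "Suc n - 4 = Suc (n - 4)" using assms by linarith
  have "sum ?f {0..<quilt (n - 4)} + sum ?f {quilt (n - 4)..<quilt (Suc (n - 4))} = sum ?f {0..<quilt (Suc (n - 4))}"
    by (rule sum.atLeastLessThan_concat) auto
  moreover have "summand_poly (n - 4) y = sum ?f {quilt (n - 4)..<quilt (Suc (n - 4))}"
    by (simp add: summand_poly_def fq_eq_quilt)
  moreover have "summand_poly n y = y * sum ?f {0..<quilt (n - 4)}"
    using summand_poly_unfold[OF assms] by (simp add: atLeast0LessThan)
  moreover have "summand_poly (Suc n) y = y * sum ?f {0..<quilt (Suc (n - 4))}"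
    using summand_poly_unfold[of "Suc n" y] assms n by (simp add: atLeast0LessThan)
  ultimately show ?thesis by (metis distrib_left)
qed

text \<open>These five values are the ones that enter the conserved quantity at
  \<open>n = 6\<close>. The squares come from 6 = 4 + 2 and 8 = 7 + 1.\<close>

lemma summand_poly_initial:
  "summand_poly 2 y = y" "summand_poly 3 y = y" "summand_poly 4 y = y"
  "summand_poly 5 y = y + y\<^sup>2" "summand_poly 6 y = y + y\<^sup>2"
proof -
  have c: "greedy6_count 1 = 1" "greedy6_count 2 = 1" "greedy6_count 3 = 1" "greedy6_count 4 = 1" "greedy6_count 5 = 1" "greedy6_count 7 = 1"
    "greedy6_count 8 = 2"
    using greedy6_count_quilt[of 1] greedy6_count_quilt[of 2] greedy6_count_quilt[of 3] greedy6_count_quilt[of 4]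
      greedy6_count_quilt[of 5] greedy6_count_quilt[of 6] greedy6_count_quilt_add[of 6 1]
    by simp_all
  have "{2..<3::nat} = {2}" "{3..<4::nat} = {3}" "{4..<5::nat} = {4}" "{5..<7::nat} = {5, 6}" "{7..<9::nat} = {7, 8}"
    by auto
  then show "summand_poly 2 y = y" "summand_poly 3 y = y" "summand_poly 4 y = y"
    "summand_poly 5 y = y + y\<^sup>2" "summand_poly 6 y = y + y\<^sup>2"
    by (simp_all add: summand_poly_def fq_eq_quilt c greedy6_count_6)
qed

section \<open>The dominant root and the uniform limit\<close>

definition plastic :: real where
  "plastic = (SOME x. 13247 / 10000 < x \<and> x < 13248 / 10000 \<and> x ^ 3 = x + 1)"

text \<open>Intermediate value theorem on a rational interval. The tight bounds let later
  inequalities in the root be settled by linear arithmetic.\<close>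

lemma plastic: "13247 / 10000 < plastic" "plastic < 13248 / 10000" "plastic ^ 3 = plastic + 1"
proof -
  have "\<exists>x\<ge>13247 / 10000. x \<le> 13248 / 10000 \<and> x ^ 3 - x = (1::real)"
    by (rule IVT') (auto simp: power3_eq_cube intro!: continuous_intros)
  then obtain x :: real where x: "13247 / 10000 \<le> x" "x \<le> 13248 / 10000" "x ^ 3 = x + 1" by force
  moreover have "(13247 / 10000 :: real) ^ 3 \<noteq> 13247 / 10000 + 1" "(13248 / 10000 :: real) ^ 3 \<noteq> 13248 / 10000 + 1"
    by (simp_all add: power3_eq_cube)
  then have "x \<noteq> 13247 / 10000" "x \<noteq> 13248 / 10000" using x(3) by metis+
  ultimately have "\<exists>x::real. 13247 / 10000 < x \<and> x < 13248 / 10000 \<and> x ^ 3 = x + 1" by force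
  from someI_ex[OF this] show "13247 / 10000 < plastic" "plastic < 13248 / 10000" "plastic ^ 3 = plastic + 1"
    unfolding plastic_def by blast+
qed

lemma plastic_quintic: "plastic ^ 5 - plastic ^ 4 = 1"
proof -
  have "plastic ^ 5 - plastic ^ 4 - 1 = (plastic ^ 3 - plastic - 1) * (plastic\<^sup>2 - plastic + 1)"
    by (simp add: algebra_simps eval_nat_numeral)
  then show ?thesis using plastic(3) by simp
qed

text \<open>The last condition bounds \<open>1 - 1 / z\<close> below \<open>1/4\<close>; at the plastic number its value is
  about \<open>0.2451\<close>.\<close>
definition branch_region :: "complex set" where
  "branch_region = {z. 1 < Re z \<and> norm z < 2 \<and> z\<^sup>2 - z + 1 \<noteq> 0 \<and> norm (z - 1) < 0.249 * norm z}"

lemma open_branch_region: "open branch_region"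
  unfolding branch_region_def
  by (intro open_Collect_conj open_Collect_less open_Collect_neq continuous_intros)

lemma plastic_in_branch_region: "of_real plastic \<in> branch_region"
proof -
  have "(complex_of_real plastic)\<^sup>2 - of_real plastic + 1 = of_real (plastic * (plastic - 1) + 1)"
    by (simp add: power2_eq_square algebra_simps)
  moreover have "plastic * (plastic - 1) + 1 > 0" using plastic by (intro add_pos_pos mult_pos_pos) auto
  ultimately have "(complex_of_real plastic)\<^sup>2 - of_real plastic + 1 \<noteq> 0"
    by (metis less_irrefl of_real_eq_0_iff)
  moreover have "complex_of_real plastic - 1 = of_real (plastic - 1)" by simp
  then have "norm (complex_of_real plastic - 1) = plastic - 1" using plastic by (simp only: norm_of_real)
  ultimately show ?thesis using plastic by (simp add: branch_region_def)
qed

text \<open>The map z^5 - z^4 sends the plastic number p to 1 with derivative p^3 (5 p - 4), which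
  is nonzero. It thus has a local holomorphic inverse \<open>g\<close>, and the branch is
  \<open>g (exp w)\<close>.\<close>

lemma exists_branch:
  obtains r l where "0 < r" "l holomorphic_on ball 0 r" "l 0 = of_real plastic"
    "\<And>w. w \<in> ball 0 r \<Longrightarrow> l w ^ 5 - l w ^ 4 = exp w" "\<And>w. w \<in> ball 0 r \<Longrightarrow> l w \<in> branch_region"
proof -
  define f :: "complex \<Rightarrow> complex" where "f = (\<lambda>z. z ^ 5 - z ^ 4)"
  let ?p = "complex_of_real plastic"
  have holf: "f holomorphic_on S" for S unfolding f_def by (intro holomorphic_intros)
  have "(f has_field_derivative 5 * ?p ^ 4 - 4 * ?p ^ 3) (at ?p)"
    unfolding f_def by (auto intro!: derivative_eq_intros)
  then have "deriv f ?p = 5 * ?p ^ 4 - 4 * ?p ^ 3" by (rule DERIV_imp_deriv)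
  also have "\<dots> = of_real (plastic ^ 3 * (5 * plastic - 4))"
    by (simp add: algebra_simps eval_nat_numeral)
  also have "\<dots> \<noteq> 0" using plastic by (subst of_real_eq_0_iff) simp
  finally have dnz: "deriv f ?p \<noteq> 0" .
  \<comment> \<open>The disc is chosen inside \<open>branch_region\<close>, so all values of the
    branch inherit the bounds stated there.\<close>
  obtain s where s: "s > 0" "ball ?p s \<subseteq> branch_region" "inj_on f (ball ?p s)"
    by (rule has_complex_derivative_locally_injective[OF holf plastic_in_branch_region open_branch_region dnz])
  obtain g where g: "g holomorphic_on (f ` ball ?p s)" "\<And>z. z \<in> ball ?p s \<Longrightarrow> g (f z) = z"
    by (rule holomorphic_has_inverse[OF holf open_ball s(3)]) blast
  have "f ?p = of_real (plastic ^ 5 - plastic ^ 4)" by (simp add: f_def)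
  then have fp: "f ?p = 1" by (simp only: plastic_quintic of_real_1)
  have "open (f ` ball ?p s)" using open_mapping_thm3[OF holf open_ball s(3)] .
  then have op: "open (exp -` (f ` ball ?p s))"
    by (rule continuous_open_vimage) (rule isCont_exp)
  have "f ?p \<in> f ` ball ?p s" using s(1) by (intro imageI) simp
  then have "0 \<in> exp -` (f ` ball ?p s)" by (simp add: fp)
  with op obtain r where r: "r > 0" "ball 0 r \<subseteq> exp -` (f ` ball ?p s)"
    by (rule openE)
  define l where "l = (\<lambda>w. g (exp w))"
  have *: "f (l w) = exp w \<and> l w \<in> ball ?p s" if "w \<in> ball 0 r" for w
  proof -
    have "exp w \<in> f ` ball ?p s" using r(2) that by blast
    then obtain z where "z \<in> ball ?p s" "exp w = f z" by blast
    then show ?thesis using g(2) by (simp add: l_def)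
  qed
  show ?thesis
  proof (rule that[OF r(1), of l])
    show "l holomorphic_on ball 0 r"
      unfolding l_def
      by (rule holomorphic_on_compose_gen[OF holomorphic_on_exp g(1), unfolded o_def]) (use r(2) in blast)
    show "l 0 = of_real plastic" using g(2)[of ?p] fp s(1) by (simp add: l_def)
    show "l w ^ 5 - l w ^ 4 = exp w" "l w \<in> branch_region" if "w \<in> ball 0 r" for w
      using *[OF that] s(2) unfolding f_def by blast+
  qed
qed

text \<open>Limit of \<open>T n w\<close> with \<open>z = l w\<close>: the conserved quantity is z^2
  (z - 1) (z^2 - z + 1), and it has to be divided by 1 + 4 k = (5 z - 4) / z.\<close>

definition amplitude :: "'a::field \<Rightarrow> 'a" where
  "amplitude z = z ^ 3 * (z - 1) * (z\<^sup>2 - z + 1) / (5 * z - 4)"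

text \<open>With \<open>y = z^5 - z^4\<close>, the next two functions are \<open>y d/dy\<close> applied once and twice to
  \<open>ln (amplitude z)\<close>; note \<open>y d/dy = z (z - 1) / (5 z - 4) d/dz\<close>.\<close>
definition amplitude_logderiv :: "'a::field \<Rightarrow> 'a" where
  "amplitude_logderiv z =
     (4 * z - 3 + (2 * z ^ 3 - 3 * z\<^sup>2 + z) / (z\<^sup>2 - z + 1)) / (5 * z - 4) - 5 * (z\<^sup>2 - z) / (5 * z - 4)\<^sup>2"

definition amplitude_logderiv2 :: "'a::field \<Rightarrow> 'a" where
  "amplitude_logderiv2 z =
     (106 * z ^ 4 - 5 * z ^ 5 - 252 * z ^ 3 + 220 * z\<^sup>2 - 74 * z)
       / ((5 * z - 4) ^ 3 * (z\<^sup>2 - z + 1)\<^sup>2) * (z * (z - 1) / (5 * z - 4))"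

lemma amplitude_deriv:
  fixes z :: complex
  assumes "5 * z - 4 \<noteq> 0"
  shows "(amplitude has_field_derivative z\<^sup>2 * (6 * z ^ 3 - 10 * z\<^sup>2 + 8 * z - 3) / (5 * z - 4)
      - 5 * (z ^ 3 * (z - 1) * (z\<^sup>2 - z + 1)) / (5 * z - 4)\<^sup>2) (at z)"
proof -
  have "((\<lambda>z. z ^ 3 * (z - 1) * (z\<^sup>2 - z + 1)) has_field_derivative z\<^sup>2 * (6 * z ^ 3 - 10 * z\<^sup>2 + 8 * z - 3)) (at z)"
    by (rule derivative_eq_intros refl)+ (simp add: algebra_simps eval_nat_numeral)
  moreover have "((\<lambda>z. 5 * z - 4) has_field_derivative 5) (at z)"
    by (rule derivative_eq_intros refl | simp)+
  ultimately show ?thesis unfolding amplitude_def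
    by (rule DERIV_cong[OF DERIV_divide]) (use assms in \<open>simp_all add: diff_divide_distrib power2_eq_square mult.commute\<close>)
qed

text \<open>Clears the nested fraction, both for comparison with the derivative of
  \<open>amplitude\<close> and for reading off the sign at the plastic number.\<close>

lemma amplitude_logderiv_eq:
  fixes z :: "'a::field"
  assumes "5 * z - 4 \<noteq> 0" "z\<^sup>2 - z + 1 \<noteq> 0"
  shows "amplitude_logderiv z = (6 * z ^ 3 - 10 * z\<^sup>2 + 8 * z - 3) / ((5 * z - 4) * (z\<^sup>2 - z + 1))
    - 5 * (z\<^sup>2 - z) / (5 * z - 4)\<^sup>2"
proof -
  have "4 * z - 3 + (2 * z ^ 3 - 3 * z\<^sup>2 + z) / (z\<^sup>2 - z + 1)
    = ((4 * z - 3) * (z\<^sup>2 - z + 1) + (2 * z ^ 3 - 3 * z\<^sup>2 + z)) / (z\<^sup>2 - z + 1)"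
    using assms(2) by (simp add: add_divide_distrib)
  also have "(4 * z - 3) * (z\<^sup>2 - z + 1) + (2 * z ^ 3 - 3 * z\<^sup>2 + z) = 6 * z ^ 3 - 10 * z\<^sup>2 + 8 * z - 3"
    by (simp add: algebra_simps eval_nat_numeral)
  finally show ?thesis by (simp add: amplitude_logderiv_def mult.commute)
qed

text \<open>\<open>exists_branch\<close> gives mere existence; the locale fixes one branch for all
  analytic lemmas and is interpreted in the final theorem.\<close>

locale greedy_branch =
  fixes r :: real and l :: "complex \<Rightarrow> complex"
  assumes r_pos: "0 < r"
    and holo_l: "l holomorphic_on ball 0 r"
    and l_0: "l 0 = of_real plastic"
    and l_eq: "w \<in> ball 0 r \<Longrightarrow> l w ^ 5 - l w ^ 4 = exp w"
    and l_region: "w \<in> ball 0 r \<Longrightarrow> l w \<in> branch_region"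
begin

lemma l_bounds:
  assumes "w \<in> ball 0 r"
  shows "1 < Re (l w)" "1 < norm (l w)" "norm (l w) < 2" "l w \<noteq> 0" "(l w)\<^sup>2 - l w + 1 \<noteq> 0"
    "5 * l w - 4 \<noteq> 0" "1 < norm (5 * l w - 4)" "norm (l w - 1) < 0.249 * norm (l w)"
proof -
  show 1: "1 < Re (l w)" "norm (l w) < 2" "(l w)\<^sup>2 - l w + 1 \<noteq> 0" "norm (l w - 1) < 0.249 * norm (l w)"
    using l_region[OF assms] by (simp_all add: branch_region_def)
  show 2: "1 < norm (l w)" using 1(1) complex_Re_le_cmod[of "l w"] by simp
  show "1 < norm (5 * l w - 4)" using 1(1) complex_Re_le_cmod[of "5 * l w - 4"] by simp
  then show "5 * l w - 4 \<noteq> 0" by auto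
  show "l w \<noteq> 0" using 2 by auto
qed

section \<open>The normalised polynomials and their geometric convergence\<close>

definition T :: "nat \<Rightarrow> complex \<Rightarrow> complex" where
  "T n w = summand_poly n (exp w) / l w ^ n"

definition Tlim :: "complex \<Rightarrow> complex" where
  "Tlim w = amplitude (l w)"

text \<open>Substituting exp w = l^4 (l - 1) cancels l^4 and leaves (l - 1) / l as coefficient of
  the delayed term.\<close>

lemma T_Suc:
  assumes w: "w \<in> ball 0 r" and n: "n \<ge> 6"
  shows "T (Suc n) w = T n w / l w + (l w - 1) / l w * T (n - 4) w"
proof -
  have pw: "l w ^ Suc n = l w ^ 5 * l w ^ (n - 4)"
    using n by (simp add: power_add[symmetric] del: power_Suc)
  define S where "S = summand_poly (n - 4) (exp w)"
  have "exp w = l w ^ 4 * (l w - 1)" using l_eq[OF w] by (simp add: algebra_simps eval_nat_numeral)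
  then have "exp w * S / (l w ^ 5 * l w ^ (n - 4)) = (l w ^ 4 * ((l w - 1) * S)) / (l w ^ 4 * (l w * l w ^ (n - 4)))"
    by (simp add: eval_nat_numeral mult.assoc)
  also have "\<dots> = (l w - 1) * S / (l w * l w ^ (n - 4))"
    using l_bounds(4)[OF w] by (subst mult_divide_mult_cancel_left) auto
  finally have "exp w * summand_poly (n - 4) (exp w) / l w ^ Suc n = (l w - 1) / l w * T (n - 4) w"
    unfolding pw T_def S_def by simp
  moreover have "T (Suc n) w = summand_poly n (exp w) / l w ^ Suc n
      + exp w * summand_poly (n - 4) (exp w) / l w ^ Suc n"
    unfolding T_def summand_poly_Suc[OF n] by (rule add_divide_distrib)
  moreover have "summand_poly n (exp w) / l w ^ Suc n = T n w / l w" by (simp add: T_def)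
  ultimately show ?thesis by simp
qed

text \<open>Value of the conserved quantity at \<open>n = 6\<close>, with \<open>z\<close> for
  \<open>l w\<close> and \<open>y\<close> for \<open>exp w\<close>; the fractions are
  \<open>T 6\<close> down to \<open>T 2\<close>.\<close>

lemma T_invariant_initial:
  fixes z y :: complex
  assumes "z \<noteq> 0" "5 * z - 4 \<noteq> 0" "y = z ^ 5 - z ^ 4"
  shows "(y + y\<^sup>2) / z ^ 6 + (z - 1) / z * ((y + y\<^sup>2) / z ^ 5 + y / z ^ 4 + y / z ^ 3 + y / z ^ 2)
     = (1 + 4 * ((z - 1) / z)) * amplitude z"
proof -
  have y: "y = z ^ 4 * (z - 1)" using assms(3) by (simp add: algebra_simps eval_nat_numeral)
  have a: "(1 + 4 * ((z - 1) / z)) * amplitude z = z ^ 2 * (z - 1) * (z\<^sup>2 - z + 1)"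
  proof -
    have "1 + 4 * ((z - 1) / z) = (5 * z - 4) / z" using assms by (simp add: field_simps)
    then show ?thesis using assms(1,2) by (simp add: amplitude_def power3_eq_cube power2_eq_square)
  qed
  have z: "z ^ 6 = z ^ 4 * z\<^sup>2" "z ^ 5 = z ^ 4 * z"
    by (simp_all add: eval_nat_numeral)
  have yy: "y + y\<^sup>2 = z ^ 4 * ((z - 1) * (1 + y))" using y by algebra
  have "(y + y\<^sup>2) / z ^ 6 = (z - 1) * (1 + y) / z\<^sup>2" "(y + y\<^sup>2) / z ^ 5 = (z - 1) * (1 + y) / z"
    unfolding yy z using assms(1) by (intro mult_divide_mult_cancel_left; simp)+
  moreover have "y / z ^ 4 = z - 1" unfolding y using assms(1) by simp
  moreover have "y / z ^ 3 = z * (z - 1)"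
  proof -
    have "y = z ^ 3 * (z * (z - 1))" unfolding y by (simp add: eval_nat_numeral)
    then show ?thesis using assms(1) by (metis nonzero_mult_div_cancel_left power_not_zero)
  qed
  moreover have "y / z ^ 2 = z\<^sup>2 * (z - 1)"
  proof -
    have "y = z ^ 2 * (z\<^sup>2 * (z - 1))" unfolding y by (simp add: eval_nat_numeral)
    then show ?thesis using assms(1) by (metis nonzero_mult_div_cancel_left power_not_zero)
  qed
  ultimately have "(y + y\<^sup>2) / z ^ 6 + (z - 1) / z * ((y + y\<^sup>2) / z ^ 5 + y / z ^ 4 + y / z ^ 3 + y / z ^ 2)
     = (z - 1) * (1 + y) / z\<^sup>2 + (z - 1) / z * ((z - 1) * (1 + y) / z + (z - 1) + z * (z - 1) + z\<^sup>2 * (z - 1))"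
    by simp
  \<comment> \<open>The terms with 1 + y combine through 1 + (z - 1) = z, the others through (z - 1)
    (1 + z + z^2) = z^3 - 1.\<close>
  also have "\<dots> = (z - 1) * (y + z ^ 3) / z"
    using assms(1) by (simp add: divide_simps) (simp add: algebra_simps eval_nat_numeral)
  also have "\<dots> = z ^ 2 * (z - 1) * (z\<^sup>2 - z + 1)"
    using assms(1) unfolding y by (simp add: divide_simps) (simp add: algebra_simps eval_nat_numeral)
  finally have "(y + y\<^sup>2) / z ^ 6 + (z - 1) / z * ((y + y\<^sup>2) / z ^ 5 + y / z ^ 4 + y / z ^ 3 + y / z ^ 2)
     = z ^ 2 * (z - 1) * (z\<^sup>2 - z + 1)" .
  then show ?thesis using a by simp
qed

text \<open>With k = (l - 1) / l one has 1 / l = 1 - k, so T(n+1) - T(n) = k (T(n-4) - T(n)).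
  Shifting the window of four terms changes its sum by T(n) - T(n-4), which compensates
  exactly.\<close>

lemma T_invariant:
  assumes w: "w \<in> ball 0 r" and "n \<ge> 6"
  shows "T n w + (l w - 1) / l w * (T (n - 1) w + T (n - 2) w + T (n - 3) w + T (n - 4) w)
     = (1 + 4 * ((l w - 1) / l w)) * Tlim w"
  using assms(2)
proof (induction n rule: nat_induct_at_least)
  case base
  show ?case
    using T_invariant_initial[OF l_bounds(4,6)[OF w] l_eq[OF w, symmetric]]
    by (simp add: T_def Tlim_def summand_poly_initial)
next
  case (Suc n)
  define k where "k = (l w - 1) / l w"
  have k: "1 / l w = 1 - k" using l_bounds(4)[OF w] by (simp add: k_def field_simps)
  have "T (Suc n) w = (1 / l w) * T n w + k * T (n - 4) w"
    using T_Suc[OF w Suc(1)] by (simp add: k_def)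
  also have "\<dots> = (1 - k) * T n w + k * T (n - 4) w" by (simp only: k)
  finally have step: "T (Suc n) w = (1 - k) * T n w + k * T (n - 4) w" .
  have "Suc n - 2 = n - 1" "Suc n - 3 = n - 2" "Suc n - 4 = n - 3" using Suc(1) by auto
  then have "T (Suc n) w + k * (T (Suc n - 1) w + T (Suc n - 2) w + T (Suc n - 3) w + T (Suc n - 4) w)
     = T n w + k * (T (n - 1) w + T (n - 2) w + T (n - 3) w + T (n - 4) w)"
    unfolding step by (simp add: algebra_simps)
  then show ?case using Suc(2) by (simp only: k_def)
qed

text \<open>Crude bounds from 1 < |l| < 2, uniform in \<open>w\<close>: |exp w| is at most 32 + 16 =
  48, then 48 + 48^2 = 2352, and 168 = 8 * 3 * 7.\<close>

lemma T_initial_bound: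
  assumes w: "w \<in> ball 0 r" and n: "n \<in> {2..5}"
  shows "norm (T n w) \<le> 2352" "norm (Tlim w) \<le> 168"
proof -
  note b = l_bounds[OF w]
  have pw: "norm (l w) ^ m \<le> 2 ^ m" for m using b(3) by (intro power_mono) auto
  have e: "norm (exp w) \<le> 48"
  proof -
    have "norm (exp w) \<le> norm (l w ^ 5) + norm (l w ^ 4)"
      unfolding l_eq[OF w, symmetric] by (rule norm_triangle_ineq4)
    also have "\<dots> \<le> 32 + 16" using pw[of 5] pw[of 4] by (intro add_mono) (auto simp: norm_power)
    finally show ?thesis by simp
  qed
  have e2: "norm (exp w + (exp w)\<^sup>2) \<le> 48 + 48\<^sup>2"
    using e power_mono[OF e, of 2] by (intro norm_triangle_mono) (simp_all add: norm_power del: norm_exp_eq_Re)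
  have "n = 2 \<or> n = 3 \<or> n = 4 \<or> n = 5" using n by auto
  then have "norm (summand_poly n (exp w)) \<le> 2352"
    using e e2 by (auto simp: summand_poly_initial)
  moreover have "1 \<le> norm (l w) ^ n" using b(2) by (intro one_le_power) auto
  ultimately have "norm (summand_poly n (exp w)) / norm (l w) ^ n \<le> 2352 / 1"
    by (intro frac_le) auto
  then show "norm (T n w) \<le> 2352" by (simp add: T_def norm_divide norm_power)
  have l1: "norm (l w - 1) \<le> 3" using norm_triangle_ineq4[of "l w" 1] b(3) by simp
  have "norm ((l w)\<^sup>2 - l w + 1) \<le> norm ((l w)\<^sup>2) + norm (l w) + 1"
    using norm_triangle_ineq4[of "(l w)\<^sup>2" "l w"] norm_triangle_ineq[of "(l w)\<^sup>2 - l w" 1] by simp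
  then have l2: "norm ((l w)\<^sup>2 - l w + 1) \<le> 7" using pw[of 2] b(3) by (simp add: norm_power)
  have "norm (l w ^ 3 * (l w - 1) * ((l w)\<^sup>2 - l w + 1)) \<le> 8 * 3 * 7"
    unfolding norm_mult using pw[of 3] l1 l2 by (intro mult_mono) (auto simp: norm_power)
  then have "norm (l w ^ 3 * (l w - 1) * ((l w)\<^sup>2 - l w + 1)) / norm (5 * l w - 4) \<le> 168 / 1"
    using b(7) by (intro frac_le) auto
  then show "norm (Tlim w) \<le> 168" by (simp add: Tlim_def amplitude_def norm_divide)
qed

text \<open>By the invariant, each deviation is -k times the sum of the previous four. As |k| is at
  most 0.249, the rate 0.999 works: 0.249 (0.999^3 + 0.999^2 + 0.999 + 1) is below 0.999^4. The
  factor 3000 leaves room for the initial 2352 + 168.\<close>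

lemma T_Tlim_bound:
  assumes w: "w \<in> ball 0 r" and "n \<ge> 2"
  shows "norm (T n w - Tlim w) \<le> 3000 * 0.999 ^ n"
  using assms(2)
proof (induction n rule: less_induct)
  case (less n)
  let ?E = "\<lambda>n. T n w - Tlim w"
  show ?case
  proof (cases "n < 6")
    case True
    then have "norm (?E n) \<le> 2352 + 168"
      using T_initial_bound[OF w, of n] less.prems by (intro order.trans[OF norm_triangle_ineq4] add_mono) auto
    also have "\<dots> \<le> 3000 * (0.999::real) ^ 5" by (simp add: eval_nat_numeral)
    also have "\<dots> \<le> 3000 * 0.999 ^ n" using True by (intro mult_left_mono power_decreasing) auto
    finally show ?thesis .
  next
    case False
    define k where "k = (l w - 1) / l w"
    have nk: "norm k \<le> 0.249"
      using l_bounds(2,8)[OF w] by (simp add: k_def norm_divide divide_le_eq)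
    define m where "m = n - 4"
    have m: "n = m + 4" "m \<ge> 2" using False by (auto simp: m_def)
    have "?E n = - k * (?E (m + 3) + ?E (m + 2) + ?E (m + 1) + ?E m)"
      using T_invariant[OF w, of n] False m unfolding k_def[symmetric] by (simp add: algebra_simps)
    then have "norm (?E n) = norm k * norm (?E (m + 3) + ?E (m + 2) + ?E (m + 1) + ?E m)"
      by (simp add: norm_mult)
    also have "\<dots> \<le> 0.249 * (3000 * 0.999 ^ (m + 3) + 3000 * 0.999 ^ (m + 2) + 3000 * 0.999 ^ (m + 1) + 3000 * 0.999 ^ m)"
      using m by (intro mult_mono[OF nk] norm_triangle_mono less.IH) auto
    also have "\<dots> = (0.249 * (0.999 ^ 3 + 0.999\<^sup>2 + 0.999 + 1)) * (3000 * 0.999 ^ m)"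
      by (simp add: power_add power2_eq_square power3_eq_cube algebra_simps)
    also have "\<dots> \<le> 0.999 ^ 4 * (3000 * 0.999 ^ m)"
      by (intro mult_right_mono) (auto simp: eval_nat_numeral)
    also have "\<dots> = 3000 * 0.999 ^ n" by (simp add: m power_add)
    finally show ?thesis .
  qed
qed

lemma T_uniform_limit: "uniform_limit (ball 0 r) T Tlim sequentially"
proof (rule uniform_limitI)
  fix e :: real assume "e > 0"
  have "(\<lambda>n. 3000 * 0.999 ^ n) \<longlonglongrightarrow> 3000 * (0::real)"
    by (intro tendsto_mult tendsto_const LIMSEQ_realpow_zero) auto
  then have "\<forall>\<^sub>F n in sequentially. 3000 * 0.999 ^ n < e"
    by (rule order_tendstoD) (use \<open>e > 0\<close> in simp)
  then show "\<forall>\<^sub>F n in sequentially. \<forall>w\<in>ball 0 r. dist (T n w) (Tlim w) < e"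
    using eventually_ge_at_top[of 2]
    by eventually_elim (use T_Tlim_bound in \<open>force simp: dist_norm\<close>)
qed

section \<open>Holomorphy and derivatives along the branch\<close>

lemma holo_summand_poly: "(\<lambda>w. summand_poly n (exp w :: complex)) holomorphic_on S"
  unfolding summand_poly_def by (intro holomorphic_intros)

lemma holo_T: "T n holomorphic_on ball 0 r"
  unfolding T_def[abs_def] using l_bounds(4)
  by (intro holomorphic_intros holo_summand_poly holo_l) auto

text \<open>Implicit differentiation of l^5 - l^4 = exp w, followed by cancellation of l^3.\<close>

lemma l_deriv:
  assumes w: "w \<in> ball 0 r"
  shows "(l has_field_derivative l w * (l w - 1) / (5 * l w - 4)) (at w)"
proof -
  have d: "(l has_field_derivative deriv l w) (at w)"
    using holomorphic_derivI[OF holo_l open_ball w] .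
  have "((\<lambda>w. l w ^ 5 - l w ^ 4) has_field_derivative (5 * l w ^ 4 - 4 * l w ^ 3) * deriv l w) (at w)"
    using d by (auto intro!: derivative_eq_intros simp: algebra_simps)
  then have "(exp has_field_derivative (5 * l w ^ 4 - 4 * l w ^ 3) * deriv l w) (at w)"
    by (rule has_field_derivative_transform_within_open[OF _ open_ball w]) (use l_eq in auto)
  then have "(5 * l w ^ 4 - 4 * l w ^ 3) * deriv l w = exp w" by (rule DERIV_unique) (rule DERIV_exp)
  then have "l w ^ 3 * ((5 * l w - 4) * deriv l w) = l w ^ 3 * (l w * (l w - 1))"
    unfolding l_eq[OF w, symmetric] by (simp add: algebra_simps eval_nat_numeral)
  then have "(5 * l w - 4) * deriv l w = l w * (l w - 1)" using l_bounds(4)[OF w] by simp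
  then have "deriv l w = l w * (l w - 1) / (5 * l w - 4)" using l_bounds(6)[OF w] by (simp add: field_simps)
  then show ?thesis using d by simp
qed

text \<open>\<open>l w\<close> has real part above 1 and so avoids the cut of \<open>Ln\<close>;
  powers \<open>l w ^ n\<close> become \<open>exp (of_nat n * F w)\<close>.\<close>

definition F :: "complex \<Rightarrow> complex" where "F w = Ln (l w)"

lemma exp_F: "w \<in> ball 0 r \<Longrightarrow> exp (F w) = l w"
  using l_bounds(4) by (simp add: F_def)

lemma F_deriv:
  assumes w: "w \<in> ball 0 r"
  shows "(F has_field_derivative (l w - 1) / (5 * l w - 4)) (at w)"
proof -
  have "l w \<notin> \<real>\<^sub>\<le>\<^sub>0" using l_bounds(1)[OF w] by (auto elim!: nonpos_Reals_cases)
  then have "(Ln has_field_derivative inverse (l w)) (at (l w))" by (rule has_field_derivative_Ln)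
  from DERIV_chain2[OF this l_deriv[OF w]] show ?thesis
    using l_bounds(4)[OF w] by (simp add: F_def[abs_def] mult.assoc[symmetric])
qed

lemma F_deriv2:
  assumes w: "w \<in> ball 0 r"
  shows "((\<lambda>w. (l w - 1) / (5 * l w - 4)) has_field_derivative l w * (l w - 1) / (5 * l w - 4) ^ 3) (at w)"
proof -
  have "((\<lambda>z. (z - 1) / (5 * z - 4)) has_field_derivative 1 / (5 * l w - 4)\<^sup>2) (at (l w))"
    by (rule derivative_eq_intros refl l_bounds(6)[OF w])+ (simp add: power2_eq_square)
  from DERIV_chain2[OF this l_deriv[OF w]] show ?thesis by (simp add: power2_eq_square power3_eq_cube)
qed

text \<open>Chain rule for \<open>amplitude\<close> and \<open>l\<close>, with \<open>Tlim\<close>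
  factored out. The logarithmic derivative thus appears without choosing a logarithm of
  \<open>Tlim\<close>.\<close>

lemma Tlim_deriv:
  assumes w: "w \<in> ball 0 r"
  shows "(Tlim has_field_derivative Tlim w * amplitude_logderiv (l w)) (at w)"
proof -
  define z where "z = l w"
  define d q W where "d = 5 * z - 4" and "q = z\<^sup>2 - z + 1" and "W = 6 * z ^ 3 - 10 * z\<^sup>2 + 8 * z - 3"
  note b = l_bounds(5,6)[OF w, folded z_def]
  have nz: "d \<noteq> 0" "q \<noteq> 0" using b by (simp_all add: d_def q_def)
  have "(Tlim has_field_derivative (z\<^sup>2 * W / d - 5 * (z ^ 3 * (z - 1) * q) / d\<^sup>2) * (z * (z - 1) / d)) (at w)"
    unfolding Tlim_def d_def q_def W_def z_def
    by (rule DERIV_chain2[OF amplitude_deriv l_deriv[OF w]]) (use b(2) in \<open>simp add: z_def\<close>)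
  moreover have "Tlim w = z ^ 3 * (z - 1) * q / d"
    by (simp add: Tlim_def amplitude_def z_def d_def q_def)
  moreover have "amplitude_logderiv z = W / (d * q) - 5 * (z\<^sup>2 - z) / d\<^sup>2"
    using amplitude_logderiv_eq[OF b(2,1)] by (simp add: d_def q_def W_def)
  moreover have "(z\<^sup>2 * W / d - 5 * (z ^ 3 * (z - 1) * q) / d\<^sup>2) * (z * (z - 1) / d)
      = z ^ 3 * (z - 1) * q / d * (W / (d * q) - 5 * (z\<^sup>2 - z) / d\<^sup>2)"
    using nz by (simp add: divide_simps) (simp add: algebra_simps eval_nat_numeral)
  ultimately show ?thesis by (simp only: z_def)
qed

lemma amplitude_logderiv_deriv:
  assumes w: "w \<in> ball 0 r"
  shows "((\<lambda>w. amplitude_logderiv (l w)) has_field_derivative amplitude_logderiv2 (l w)) (at w)"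
proof -
  define z where "z = l w"
  note b = l_bounds(4,5,6)[OF w, folded z_def]
  have "(amplitude_logderiv has_field_derivative (106 * z ^ 4 - 5 * z ^ 5 - 252 * z ^ 3 + 220 * z\<^sup>2 - 74 * z)
       / ((5 * z - 4) ^ 3 * (z\<^sup>2 - z + 1)\<^sup>2)) (at z)"
  proof -
    define d q where "d = 5 * z - 4" and "q = z\<^sup>2 - z + 1"
    \<comment> \<open>\<open>X1\<close> is the numerator in the derivative of
      \<open>X2 / q\<close>.\<close>
    define X2 X1 where "X2 = 2 * z ^ 3 - 3 * z\<^sup>2 + z" and "X1 = (6 * z\<^sup>2 - 6 * z + 1) * q - X2 * (2 * z - 1)"
    have nz: "d \<noteq> 0" "q \<noteq> 0" using b by (auto simp: d_def q_def)
    have "((4 + X1 / (q * q)) * d - (20 * z - 15 + 5 * X2 / q)) / (d * d)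
        = ((4 * q\<^sup>2 + X1) * d - (20 * z - 15) * q\<^sup>2 - 5 * X2 * q) / (d\<^sup>2 * q\<^sup>2)"
      using nz by (simp add: divide_simps) (simp add: algebra_simps eval_nat_numeral)
    moreover have "((10 * z - 5) * d\<^sup>2 - (5 * z\<^sup>2 - 5 * z) * (10 * d)) / d ^ 4
        = ((10 * z - 5) * d - 50 * (z\<^sup>2 - z)) / d ^ 3"
      using nz by (simp add: divide_simps) (simp add: algebra_simps eval_nat_numeral)
    moreover have "((4 * q\<^sup>2 + X1) * d - (20 * z - 15) * q\<^sup>2 - 5 * X2 * q) / (d\<^sup>2 * q\<^sup>2)
        - ((10 * z - 5) * d - 50 * (z\<^sup>2 - z)) / d ^ 3
        = (((4 * q\<^sup>2 + X1) * d - (20 * z - 15) * q\<^sup>2 - 5 * X2 * q) * d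
           - ((10 * z - 5) * d - 50 * (z\<^sup>2 - z)) * q\<^sup>2) / (d ^ 3 * q\<^sup>2)"
      (is "?M / _ - ?N / _ = _")
    proof -
      have "M / (d\<^sup>2 * q\<^sup>2) - N / d ^ 3 = (M * d - N * q\<^sup>2) / (d ^ 3 * q\<^sup>2)" for M N :: complex
        using nz by (simp add: divide_simps) (simp add: algebra_simps eval_nat_numeral)
      then show ?thesis .
    qed
    moreover have "((4 * q\<^sup>2 + X1) * d - (20 * z - 15) * q\<^sup>2 - 5 * X2 * q) * d
           - ((10 * z - 5) * d - 50 * (z\<^sup>2 - z)) * q\<^sup>2
         = 106 * z ^ 4 - 5 * z ^ 5 - 252 * z ^ 3 + 220 * z\<^sup>2 - 74 * z"
      unfolding X1_def X2_def d_def q_def by algebra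
    \<comment> \<open>The left side is the quotient rule applied to the two summands of
      \<open>amplitude_logderiv\<close>, left unreduced to match what
      \<open>derivative_eq_intros\<close> produces.\<close>
    ultimately have eq: "((4 + ((6 * z\<^sup>2 - 6 * z + 1) * q - (2 * z ^ 3 - 3 * z\<^sup>2 + z) * (2 * z - 1)) / (q * q)) * d
         - (20 * z - 15 + 5 * (2 * z ^ 3 - 3 * z\<^sup>2 + z) / q)) / (d * d)
         - ((10 * z - 5) * d\<^sup>2 - (5 * z\<^sup>2 - 5 * z) * (10 * d)) / d ^ 4
       = (106 * z ^ 4 - 5 * z ^ 5 - 252 * z ^ 3 + 220 * z\<^sup>2 - 74 * z) / (d ^ 3 * q\<^sup>2)"
      unfolding X2_def[symmetric] X1_def[symmetric] by metis
    show ?thesis unfolding amplitude_logderiv_def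
      by (rule derivative_eq_intros refl b)+ (use b eq in \<open>auto simp: d_def q_def algebra_simps\<close>)
  qed
  then show ?thesis
    unfolding amplitude_logderiv2_def z_def by (rule DERIV_chain2[OF _ l_deriv[OF w]])
qed

end

text \<open>Constant term of the mean. Reducing the numerator by z^3 = z + 1 leaves a quadratic, and
  z^2 at least 1.3247 z makes its sign a linear question.\<close>

lemma amplitude_logderiv_plastic_pos: "amplitude_logderiv plastic > 0"
proof -
  let ?z = plastic
  have sq: "13247 / 10000 * ?z \<le> ?z * ?z" using plastic by (intro mult_right_mono) auto
  have pos: "5 * ?z - 4 > 0" "?z\<^sup>2 - ?z + 1 > 0" unfolding power2_eq_square using plastic sq by linarith+
  have "amplitude_logderiv ?z = (6 * ?z ^ 3 - 10 * ?z\<^sup>2 + 8 * ?z - 3) / ((5 * ?z - 4) * (?z\<^sup>2 - ?z + 1))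
    - 5 * (?z\<^sup>2 - ?z) / (5 * ?z - 4)\<^sup>2"
    using pos by (intro amplitude_logderiv_eq) auto
  also have "\<dots> = ((6 * ?z ^ 3 - 10 * ?z\<^sup>2 + 8 * ?z - 3) * (5 * ?z - 4) - 5 * (?z\<^sup>2 - ?z) * (?z\<^sup>2 - ?z + 1))
      / ((5 * ?z - 4)\<^sup>2 * (?z\<^sup>2 - ?z + 1))"
  proof -
    have "M / (d * q) - N / d\<^sup>2 = (M * d - N * q) / (d\<^sup>2 * q)" if "d \<noteq> 0" "q \<noteq> 0" for M N d q :: real
      using that by (simp add: divide_simps) (simp add: algebra_simps eval_nat_numeral)
    with pos show ?thesis by auto
  qed
  also have "(6 * ?z ^ 3 - 10 * ?z\<^sup>2 + 8 * ?z - 3) * (5 * ?z - 4) - 5 * (?z\<^sup>2 - ?z) * (?z\<^sup>2 - ?z + 1)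
      = 25 * ?z ^ 4 - 64 * ?z ^ 3 + 70 * ?z\<^sup>2 - 42 * ?z + 12"
    by algebra
  also have "25 * ?z ^ 4 - 64 * ?z ^ 3 + 70 * ?z\<^sup>2 - 42 * ?z + 12 = 95 * (?z * ?z) - 81 * ?z - 52"
    using plastic(3) by algebra
  also have "(95 * (?z * ?z) - 81 * ?z - 52) / ((5 * ?z - 4)\<^sup>2 * (?z\<^sup>2 - ?z + 1)) > 0"
  proof (intro divide_pos_pos mult_pos_pos)
    show "95 * (?z * ?z) - 81 * ?z - 52 > 0" using plastic sq by linarith
  qed (use pos in auto)
  finally show ?thesis .
qed

text \<open>Constant term of the variance, by the same reduction modulo z^3 = z + 1.\<close>

lemma amplitude_logderiv2_plastic_pos: "amplitude_logderiv2 plastic > 0"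
proof -
  let ?z = plastic
  have sq: "13247 / 10000 * ?z \<le> ?z * ?z" using plastic by (intro mult_right_mono) auto
  have pos: "5 * ?z - 4 > 0" "?z\<^sup>2 - ?z + 1 > 0" unfolding power2_eq_square using plastic sq by linarith+
  have "106 * ?z ^ 4 - 5 * ?z ^ 5 - 252 * ?z ^ 3 + 220 * ?z\<^sup>2 - 74 * ?z = 321 * (?z * ?z) - 225 * ?z - 257"
    using plastic(3) by algebra
  moreover have "321 * (?z * ?z) - 225 * ?z - 257 > 0" using plastic sq by linarith
  ultimately show ?thesis using pos plastic unfolding amplitude_logderiv2_def
    by (intro mult_pos_pos divide_pos_pos) auto
qed

section \<open>Moments and characteristic functions\<close>

lemma amplitude_logderiv_of_real:
  "amplitude_logderiv (of_real x :: complex) = of_real (amplitude_logderiv x)"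
  by (simp add: amplitude_logderiv_def)

lemma amplitude_logderiv2_of_real:
  "amplitude_logderiv2 (of_real x :: complex) = of_real (amplitude_logderiv2 x)"
  by (simp add: amplitude_logderiv2_def)

text \<open>The general codomain serves both the real moments and the complex characteristic
  function.\<close>

lemma expectation_Y_dist:
  fixes f :: "real \<Rightarrow> 'b::{banach, second_countable_topology}"
  shows "measure_pmf.expectation (Y_dist n) f
    = (\<Sum>m\<in>{fq n..<fq (Suc n)}. f (real (greedy6_count m))) /\<^sub>R real (card {fq n..<fq (Suc n)})"
proof -
  let ?I = "{fq n..<fq (Suc n)}"
  have I: "finite ?I" "?I \<noteq> {}" by (auto simp: fq_eq_quilt)
  have "measure_pmf.expectation (Y_dist n) f
      = measure_pmf.expectation (pmf_of_set ?I) (\<lambda>m. f (real (greedy6_count m)))"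
    by (simp add: Y_dist_def)
  also have "\<dots> = (\<Sum>m\<in>?I. pmf (pmf_of_set ?I) m *\<^sub>R f (real (greedy6_count m)))"
    by (rule integral_measure_pmf) (use I in auto)
  also have "\<dots> = (\<Sum>m\<in>?I. inverse (real (card ?I)) *\<^sub>R f (real (greedy6_count m)))"
    using I by (intro sum.cong) (auto simp: divide_inverse)
  finally show ?thesis by (simp only: scaleR_sum_right)
qed

lemma summand_poly_1: "summand_poly n (1 :: complex) = of_nat (card {fq n..<fq (Suc n)})"
  by (simp add: summand_poly_def)

lemma summand_poly_1_nonzero: "summand_poly n (1 :: complex) \<noteq> 0"
  by (simp add: summand_poly_1 fq_eq_quilt)

text \<open>Cast to the complex numbers because the numerator is the derivative of
  \<open>summand_poly n (exp w)\<close> at \<open>w = 0\<close>.\<close>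

lemma Y_mean_sum:
  "complex_of_real (Y_mean n) = (\<Sum>m\<in>{fq n..<fq (Suc n)}. of_nat (greedy6_count m)) / summand_poly n 1"
  by (simp add: Y_mean_def expectation_Y_dist summand_poly_1 divide_inverse mult.commute)

lemma Y_var_sum:
  "complex_of_real (Y_var n) = (\<Sum>m\<in>{fq n..<fq (Suc n)}. (of_nat (greedy6_count m))\<^sup>2) / summand_poly n 1
     - (of_real (Y_mean n))\<^sup>2"
proof -
  let ?I = "{fq n..<fq (Suc n)}" and ?c = "\<lambda>m. real (greedy6_count m)"
  define N where "N = real (card ?I)"
  have N: "N > 0" by (simp add: N_def fq_eq_quilt)
  have mean: "sum ?c ?I = N * Y_mean n"
    using N by (simp add: Y_mean_def expectation_Y_dist N_def)
  have "Y_var n = (\<Sum>m\<in>?I. (?c m - Y_mean n)\<^sup>2) / N"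
    unfolding Y_var_def Y_mean_def[symmetric] by (simp add: expectation_Y_dist N_def divide_inverse mult.commute)
  also have "(\<Sum>m\<in>?I. (?c m - Y_mean n)\<^sup>2) = (\<Sum>m\<in>?I. (?c m)\<^sup>2 - 2 * Y_mean n * ?c m + (Y_mean n)\<^sup>2)"
    by (intro sum.cong) (auto simp: power2_eq_square algebra_simps)
  also have "\<dots> = (\<Sum>m\<in>?I. (?c m)\<^sup>2) - 2 * Y_mean n * sum ?c ?I + N * (Y_mean n)\<^sup>2"
    by (simp only: sum.distrib sum_subtractf sum_distrib_left[symmetric]) (simp add: N_def)
  also have "\<dots> / N = (\<Sum>m\<in>?I. (?c m)\<^sup>2) / N - (Y_mean n)\<^sup>2"
    using N unfolding mean by (simp add: field_simps power2_eq_square)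
  finally have "complex_of_real (Y_var n) = of_real ((\<Sum>m\<in>?I. (?c m)\<^sup>2) / N - (Y_mean n)\<^sup>2)" by simp
  then show ?thesis by (simp add: summand_poly_1 N_def)
qed

text \<open>With w = i t / s, the expectation of exp (w Y) is the generating polynomial at exp w
  divided by its value at 1; centring contributes the first factor.\<close>

lemma char_standardized:
  "char (distr (measure_pmf (map_pmf (\<lambda>y. (y - Y_mean n) / s) (Y_dist n))) borel (\<lambda>x. x)) t
   = exp (- (of_real (Y_mean n) * (\<i> * of_real (t / s)))) * (summand_poly n (exp (\<i> * of_real (t / s))) / summand_poly n 1)"
proof -
  let ?I = "{fq n..<fq (Suc n)}" and ?w = "\<i> * complex_of_real (t / s)"
  have "char (distr (measure_pmf (map_pmf (\<lambda>y. (y - Y_mean n) / s) (Y_dist n))) borel (\<lambda>x. x)) t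
      = measure_pmf.expectation (map_pmf (\<lambda>y. (y - Y_mean n) / s) (Y_dist n)) (\<lambda>x. iexp (t * x))"
    unfolding char_def by (subst integral_distr) auto
  also have "\<dots> = measure_pmf.expectation (Y_dist n) (\<lambda>y. iexp (t * ((y - Y_mean n) / s)))"
    by simp
  also have "\<dots> = (\<Sum>m\<in>?I. iexp (t * ((real (greedy6_count m) - Y_mean n) / s))) /\<^sub>R real (card ?I)"
    by (rule expectation_Y_dist)
  also have "(\<Sum>m\<in>?I. iexp (t * ((real (greedy6_count m) - Y_mean n) / s)))
      = (\<Sum>m\<in>?I. exp (- (of_real (Y_mean n) * ?w)) * exp ?w ^ greedy6_count m)"
  proof (intro sum.cong refl)
    fix m
    have "\<i> * complex_of_real (t * ((real (greedy6_count m) - Y_mean n) / s))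
        = - (of_real (Y_mean n) * ?w) + of_nat (greedy6_count m) * ?w"
      by (simp add: algebra_simps diff_divide_distrib)
    then show "iexp (t * ((real (greedy6_count m) - Y_mean n) / s))
        = exp (- (of_real (Y_mean n) * ?w)) * exp ?w ^ greedy6_count m"
      by (simp only: exp_add exp_of_nat_mult)
  qed
  also have "\<dots> = exp (- (of_real (Y_mean n) * ?w)) * summand_poly n (exp ?w)"
    by (simp only: summand_poly_def sum_distrib_left)
  finally show ?thesis
    by (simp add: summand_poly_1 scaleR_conv_of_real divide_inverse mult_ac)
qed

text \<open>The third derivative is bounded on the compact disc of radius \<open>r / 2\<close>; the
  2 in \<open>B / 2\<close> is the factorial in the remainder of
  \<open>complex_Taylor\<close>.\<close>

lemma second_order_Taylor:
  fixes f :: "complex \<Rightarrow> complex"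
  assumes "f holomorphic_on ball 0 r" "0 < r"
  obtains K \<delta> where "0 < \<delta>" "\<delta> < r"
    "\<And>w. norm w \<le> \<delta> \<Longrightarrow> norm (f w - (f 0 + deriv f 0 * w + deriv (deriv f) 0 / 2 * w\<^sup>2)) \<le> K * norm w ^ 3"
proof -
  define g where "g i = (deriv ^^ i) f" for i
  have sub: "cball 0 (r / 2) \<subseteq> ball (0::complex) r" using assms(2) by auto
  have holg: "g i holomorphic_on ball 0 r" for i
    unfolding g_def using assms(1) by (intro holomorphic_higher_deriv) auto
  have "compact (g 3 ` cball 0 (r / 2))"
    using holomorphic_on_imp_continuous_on[OF holg, of 3] sub
    by (intro compact_continuous_image continuous_on_subset[OF _ sub]) auto
  then obtain B where B: "\<And>w. w \<in> cball 0 (r / 2) \<Longrightarrow> norm (g 3 w) \<le> B"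
    by (meson bounded_iff compact_imp_bounded imageI)
  have "norm (f w - (f 0 + deriv f 0 * w + deriv (deriv f) 0 / 2 * w\<^sup>2)) \<le> (B / 2) * norm w ^ 3"
    if w: "norm w \<le> r / 2" for w
  proof -
    have "norm (g 0 w - (\<Sum>i\<le>2. g i 0 * (w - 0) ^ i / fact i)) \<le> B * norm (w - 0) ^ Suc 2 / fact 2"
    proof (rule complex_Taylor)
      show "convex (cball (0::complex) (r / 2))" by simp
      fix i x assume "x \<in> cball (0::complex) (r / 2)" "i \<le> (2::nat)"
      then have "(g i has_field_derivative deriv (g i) x) (at x)"
        using holomorphic_derivI[OF holg open_ball] sub by blast
      then show "(g i has_field_derivative g (Suc i) x) (at x within cball 0 (r / 2))"
        by (simp add: g_def has_field_derivative_at_within)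
    next
      fix x assume "x \<in> cball (0::complex) (r / 2)"
      then show "norm (g (Suc 2) x) \<le> B" using B[of x] by (simp add: numeral_3_eq_3)
    qed (use w assms(2) in auto)
    then show ?thesis by (simp add: g_def eval_nat_numeral)
  qed
  then show ?thesis using assms(2) by (intro that[of "r / 2" "B / 2"]) auto
qed

section \<open>Quasi-powers and exact formulas for the moments\<close>

context greedy_branch
begin

lemma summand_poly_exp:
  assumes "w \<in> ball 0 r"
  shows "summand_poly n (exp w) = exp (of_nat n * F w) * T n w"
  using l_bounds(4)[OF assms] by (simp add: T_def exp_of_nat_mult exp_F[OF assms])

lemma zero_in_ball: "0 \<in> ball (0::complex) r"
  using r_pos by simp

lemma T_0_nonzero: "T n 0 \<noteq> 0"
  using summand_poly_exp[OF zero_in_ball, of n] summand_poly_1_nonzero[of n] by auto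

text \<open>\<open>F1\<close> and \<open>F2\<close> are the first and second derivative of
  \<open>F\<close> on the disc; their values at 0 are the slopes of mean and variance.\<close>

definition F1 :: "complex \<Rightarrow> complex" where "F1 w = (l w - 1) / (5 * l w - 4)"
definition F2 :: "complex \<Rightarrow> complex" where "F2 w = l w * (l w - 1) / (5 * l w - 4) ^ 3"

lemma T_derivs:
  assumes "w \<in> ball 0 r"
  shows "(T n has_field_derivative deriv (T n) w) (at w)"
    "(deriv (T n) has_field_derivative deriv (deriv (T n)) w) (at w)"
  using holomorphic_derivI[OF _ open_ball assms] holo_T holomorphic_deriv[OF holo_T open_ball] by blast+

text \<open>Both sides are derivatives of \<open>summand_poly n (exp w)\<close>: termwise, and in
  the form of \<open>summand_poly_exp\<close>.\<close>

lemma summand_poly_deriv: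
  assumes w: "w \<in> ball 0 r"
  shows "(\<Sum>m\<in>{fq n..<fq (Suc n)}. of_nat (greedy6_count m) * exp w ^ greedy6_count m)
    = exp (of_nat n * F w) * (of_nat n * F1 w * T n w + deriv (T n) w)" (is "?L w = ?R w")
proof -
  have "((\<lambda>w. \<Sum>m\<in>{fq n..<fq (Suc n)}. exp (of_nat (greedy6_count m) * w)) has_field_derivative
      (\<Sum>m\<in>{fq n..<fq (Suc n)}. of_nat (greedy6_count m) * exp (of_nat (greedy6_count m) * w))) (at w)"
    by (auto intro!: derivative_eq_intros sum.cong)
  then have "((\<lambda>w. summand_poly n (exp w)) has_field_derivative ?L w) (at w)"
    by (simp only: summand_poly_def exp_of_nat_mult)
  then have "((\<lambda>w. exp (of_nat n * F w) * T n w) has_field_derivative ?L w) (at w)"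
    by (rule has_field_derivative_transform_within_open[OF _ open_ball w]) (rule summand_poly_exp)
  moreover have "((\<lambda>w. exp (of_nat n * F w) * T n w) has_field_derivative ?R w) (at w)"
    by (rule derivative_eq_intros F_deriv[folded F1_def] T_derivs w refl)+ (simp add: algebra_simps)
  ultimately show ?thesis by (rule DERIV_unique)
qed

lemma summand_poly_deriv2:
  "(\<Sum>m\<in>{fq n..<fq (Suc n)}. (of_nat (greedy6_count m) :: complex)\<^sup>2)
    = exp (of_nat n * F 0) * ((of_nat n * F1 0)\<^sup>2 * T n 0 + 2 * of_nat n * F1 0 * deriv (T n) 0
        + of_nat n * F2 0 * T n 0 + deriv (deriv (T n)) 0)" (is "?L = ?R")
proof -
  let ?f = "\<lambda>w::complex. \<Sum>m\<in>{fq n..<fq (Suc n)}. of_nat (greedy6_count m) * exp (of_nat (greedy6_count m) * w)"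
  let ?g = "\<lambda>w. exp (of_nat n * F w) * (of_nat n * F1 w * T n w + deriv (T n) w)"
  have F1': "(F1 has_field_derivative F2 w) (at w)" if "w \<in> ball 0 r" for w
    using F_deriv2[OF that] by (simp add: F1_def[abs_def] F2_def)
  have "(?f has_field_derivative ?L) (at 0)"
    by (auto intro!: derivative_eq_intros sum.cong simp: power2_eq_square)
  then have "(?g has_field_derivative ?L) (at 0)"
    by (rule has_field_derivative_transform_within_open[OF _ open_ball zero_in_ball])
      (use summand_poly_deriv[of _ n] in \<open>simp add: exp_of_nat_mult\<close>)
  moreover have "(?g has_field_derivative ?R) (at 0)"
    by (rule derivative_eq_intros F_deriv[folded F1_def] T_derivs F1' zero_in_ball refl)+
      (simp add: algebra_simps power2_eq_square)
  ultimately show ?thesis by (rule DERIV_unique)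
qed

lemma Y_mean_eq: "of_real (Y_mean n) = of_nat n * F1 0 + deriv (T n) 0 / T n 0"
proof -
  have N: "summand_poly n 1 = exp (of_nat n * F 0) * T n 0"
    using summand_poly_exp[OF zero_in_ball] by simp
  have "of_real (Y_mean n) = exp (of_nat n * F 0) * (of_nat n * F1 0 * T n 0 + deriv (T n) 0)
     / (exp (of_nat n * F 0) * T n 0)"
    unfolding Y_mean_sum N using summand_poly_deriv[OF zero_in_ball, of n] by simp
  also have "\<dots> = (of_nat n * F1 0 * T n 0 + deriv (T n) 0) / T n 0"
    by (rule mult_divide_mult_cancel_left) simp
  finally show ?thesis using T_0_nonzero[of n] by (simp add: add_divide_distrib)
qed

text \<open>The variance is the second logarithmic derivative at 0: the square of the mean cancels
  the quadratic and mixed terms of the second moment.\<close>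

lemma Y_var_eq:
  "of_real (Y_var n) = of_nat n * F2 0 + deriv (deriv (T n)) 0 / T n 0 - (deriv (T n) 0 / T n 0)\<^sup>2"
proof -
  have N: "summand_poly n 1 = exp (of_nat n * F 0) * T n 0"
    using summand_poly_exp[OF zero_in_ball] by simp
  have "exp (of_nat n * F 0) * ((of_nat n * F1 0)\<^sup>2 * T n 0 + 2 * of_nat n * F1 0 * deriv (T n) 0
        + of_nat n * F2 0 * T n 0 + deriv (deriv (T n)) 0) / (exp (of_nat n * F 0) * T n 0)
      = ((of_nat n * F1 0)\<^sup>2 * T n 0 + 2 * of_nat n * F1 0 * deriv (T n) 0
        + of_nat n * F2 0 * T n 0 + deriv (deriv (T n)) 0) / T n 0"
    by (rule mult_divide_mult_cancel_left) simp
  also have "\<dots> = (of_nat n * F1 0)\<^sup>2 + 2 * of_nat n * F1 0 * (deriv (T n) 0 / T n 0)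
        + of_nat n * F2 0 + deriv (deriv (T n)) 0 / T n 0"
    using T_0_nonzero[of n] by (simp add: add_divide_distrib)
  finally show ?thesis
    unfolding Y_var_sum N summand_poly_deriv2 Y_mean_eq by (simp add: power2_eq_square algebra_simps)
qed

section \<open>Limits of the moments and of the characteristic functions\<close>

lemma Tlim_0_nonzero: "Tlim 0 \<noteq> 0"
  using l_bounds(1,4,5,6)[OF zero_in_ball] by (auto simp: Tlim_def amplitude_def)

lemma deriv_Tlim: "w \<in> ball 0 r \<Longrightarrow> deriv Tlim w = Tlim w * amplitude_logderiv (l w)"
  by (rule DERIV_imp_deriv) (rule Tlim_deriv)

lemma deriv2_Tlim:
  "deriv (deriv Tlim) 0 = Tlim 0 * ((amplitude_logderiv (l 0))\<^sup>2 + amplitude_logderiv2 (l 0))"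
proof (rule DERIV_imp_deriv)
  have "((\<lambda>w. Tlim w * amplitude_logderiv (l w)) has_field_derivative
      Tlim 0 * ((amplitude_logderiv (l 0))\<^sup>2 + amplitude_logderiv2 (l 0))) (at 0)"
    by (rule derivative_eq_intros Tlim_deriv amplitude_logderiv_deriv zero_in_ball refl)+
      (simp add: algebra_simps power2_eq_square)
  then show "(deriv Tlim has_field_derivative
      Tlim 0 * ((amplitude_logderiv (l 0))\<^sup>2 + amplitude_logderiv2 (l 0))) (at 0)"
    by (rule has_field_derivative_transform_within_open[OF _ open_ball zero_in_ball]) (simp add: deriv_Tlim)
qed

text \<open>Weierstrass: locally uniform convergence of holomorphic functions carries over to all
  derivatives.\<close>

lemma higher_deriv_T_tendsto: "(\<lambda>n. (deriv ^^ m) (T n) 0) \<longlonglongrightarrow> (deriv ^^ m) Tlim 0"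
  by (rule higher_deriv_complex_uniform_limit[OF T_uniform_limit _ _ open_ball zero_in_ball])
    (auto simp: holo_T)

lemma T_0_tendsto: "(\<lambda>n. T n 0) \<longlonglongrightarrow> Tlim 0"
  using higher_deriv_T_tendsto[of 0] by simp

lemma T_logderiv_tendsto: "(\<lambda>n. deriv (T n) 0 / T n 0) \<longlonglongrightarrow> amplitude_logderiv (l 0)"
proof -
  have "(\<lambda>n. deriv (T n) 0 / T n 0) \<longlonglongrightarrow> deriv Tlim 0 / Tlim 0"
    using higher_deriv_T_tendsto[of 1] T_0_tendsto Tlim_0_nonzero by (intro tendsto_divide) auto
  then show ?thesis using Tlim_0_nonzero by (simp add: deriv_Tlim[OF zero_in_ball])
qed

lemma T_logderiv2_tendsto:
  "(\<lambda>n. deriv (deriv (T n)) 0 / T n 0 - (deriv (T n) 0 / T n 0)\<^sup>2) \<longlonglongrightarrow> amplitude_logderiv2 (l 0)"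
proof -
  have "(\<lambda>n. deriv (deriv (T n)) 0 / T n 0 - (deriv (T n) 0 / T n 0)\<^sup>2)
      \<longlonglongrightarrow> deriv (deriv Tlim) 0 / Tlim 0 - (amplitude_logderiv (l 0))\<^sup>2"
    using higher_deriv_T_tendsto[of 2] T_0_tendsto Tlim_0_nonzero
    by (intro tendsto_divide tendsto_diff tendsto_power T_logderiv_tendsto) (auto simp: numeral_2_eq_2)
  then show ?thesis using Tlim_0_nonzero by (simp add: deriv2_Tlim)
qed

lemma Y_mean_asymp:
  "(\<lambda>n. Y_mean n - ((plastic - 1) / (5 * plastic - 4) * real n + amplitude_logderiv plastic)) \<longlonglongrightarrow> 0"
proof -
  have "(\<lambda>n. deriv (T n) 0 / T n 0 - amplitude_logderiv (l 0)) \<longlonglongrightarrow> 0"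
    using T_logderiv_tendsto by (simp add: LIM_zero)
  also have "(\<lambda>n. deriv (T n) 0 / T n 0 - amplitude_logderiv (l 0))
    = (\<lambda>n. complex_of_real (Y_mean n - ((plastic - 1) / (5 * plastic - 4) * real n + amplitude_logderiv plastic)))"
    by (simp add: Y_mean_eq F1_def l_0 amplitude_logderiv_of_real mult.commute)
  finally show ?thesis by (simp only: tendsto_of_real_iff[where ?'a = complex, of _ 0, simplified])
qed

lemma Y_var_asymp:
  "(\<lambda>n. Y_var n - (plastic * (plastic - 1) / (5 * plastic - 4) ^ 3 * real n + amplitude_logderiv2 plastic)) \<longlonglongrightarrow> 0"
proof -
  have "(\<lambda>n. deriv (deriv (T n)) 0 / T n 0 - (deriv (T n) 0 / T n 0)\<^sup>2 - amplitude_logderiv2 (l 0)) \<longlonglongrightarrow> 0"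
    using T_logderiv2_tendsto by (simp add: LIM_zero)
  also have "(\<lambda>n. deriv (deriv (T n)) 0 / T n 0 - (deriv (T n) 0 / T n 0)\<^sup>2 - amplitude_logderiv2 (l 0))
    = (\<lambda>n. complex_of_real (Y_var n - (plastic * (plastic - 1) / (5 * plastic - 4) ^ 3 * real n + amplitude_logderiv2 plastic)))"
    by (simp add: Y_var_eq F2_def l_0 amplitude_logderiv2_of_real mult.commute diff_diff_eq2 add_diff_eq)
  finally show ?thesis by (simp only: tendsto_of_real_iff[where ?'a = complex, of _ 0, simplified])
qed

text \<open>With w = i t / sigma, the exponent n (F w - F 0) - mean w is expanded to second order at
  0. The linear terms cancel up to a bounded multiple of w, n w^2 tends to -t^2 / C, and the
  remainder vanishes.\<close>

lemma char_standardized_tendsto: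
  "(\<lambda>n. char (distr (measure_pmf (map_pmf (\<lambda>y. (y - Y_mean n) / sqrt (Y_var n)) (Y_dist n))) borel (\<lambda>x. x)) t)
    \<longlonglongrightarrow> of_real (exp (- (t\<^sup>2) / 2))"
proof -
  define A where "A = (plastic - 1) / (5 * plastic - 4)"
  define C where "C = plastic * (plastic - 1) / (5 * plastic - 4) ^ 3"
  define v where "v = Y_var"
  define w where "w n = \<i> * complex_of_real (t / sqrt (v n))" for n
  have C: "C > 0" using plastic unfolding C_def by (intro divide_pos_pos mult_pos_pos) auto
  have F1: "deriv F 0 = of_real A"
    using DERIV_imp_deriv[OF F_deriv[OF zero_in_ball]] by (simp add: A_def l_0)
  have "deriv F w = F1 w" if "w \<in> ball 0 r" for w
    using DERIV_imp_deriv[OF F_deriv[OF that]] by (simp add: F1_def)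
  moreover have "(F1 has_field_derivative F2 0) (at 0)"
    using F_deriv2[OF zero_in_ball] by (simp add: F1_def[abs_def] F2_def)
  ultimately have "(deriv F has_field_derivative F2 0) (at 0)"
    using has_field_derivative_transform_within_open[OF _ open_ball zero_in_ball] by metis
  then have F2: "deriv (deriv F) 0 = of_real C"
    by (simp add: DERIV_imp_deriv F2_def C_def l_0)

  have mean: "(\<lambda>n. Y_mean n - A * real n) \<longlonglongrightarrow> amplitude_logderiv plastic"
  proof -
    have "(\<lambda>n. Y_mean n - (A * real n + amplitude_logderiv plastic) + amplitude_logderiv plastic) \<longlonglongrightarrow> 0 + amplitude_logderiv plastic"
      unfolding A_def by (intro tendsto_add Y_mean_asymp tendsto_const)
    then show ?thesis by (simp add: algebra_simps)
  qed
  have inv_n: "(\<lambda>n. inverse (real n)) \<longlonglongrightarrow> 0" by (rule lim_inverse_n)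
  have "(\<lambda>n. (v n - (C * real n + amplitude_logderiv2 plastic)) * inverse (real n)
      + amplitude_logderiv2 plastic * inverse (real n) + C) \<longlonglongrightarrow> 0 * 0 + amplitude_logderiv2 plastic * 0 + C"
    unfolding C_def v_def by (intro tendsto_intros Y_var_asymp inv_n)
  then have "(\<lambda>n. (v n - (C * real n + amplitude_logderiv2 plastic)) * inverse (real n)
      + amplitude_logderiv2 plastic * inverse (real n) + C) \<longlonglongrightarrow> C" by simp
  then have "(\<lambda>n. v n * inverse (real n)) \<longlonglongrightarrow> C"
  proof (rule Lim_transform_eventually)
    show "\<forall>\<^sub>F n in sequentially. (v n - (C * real n + amplitude_logderiv2 plastic)) * inverse (real n)
      + amplitude_logderiv2 plastic * inverse (real n) + C = v n * inverse (real n)"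
      using eventually_gt_at_top[of 0] by eventually_elim (simp add: field_simps)
  qed
  then have vn: "(\<lambda>n. v n / real n) \<longlonglongrightarrow> C" by (simp add: divide_inverse)
  \<comment> \<open>Needed to replace the square of \<open>sqrt (v n)\<close> by
    \<open>v n\<close>.\<close>
  have v_pos: "\<forall>\<^sub>F n in sequentially. v n > 0"
    using order_tendstoD(1)[OF vn C] eventually_gt_at_top[of 0]
    by eventually_elim (simp add: zero_less_divide_iff)
  have nv: "(\<lambda>n. real n / v n) \<longlonglongrightarrow> 1 / C"
    using tendsto_divide[OF tendsto_const[of 1] vn] C by simp
  have inv_v: "(\<lambda>n. 1 / v n) \<longlonglongrightarrow> 0"
  proof -
    have "(\<lambda>n. real n / v n * inverse (real n)) \<longlonglongrightarrow> 1 / C * 0"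
      by (intro tendsto_mult nv inv_n)
    then have "(\<lambda>n. real n / v n * inverse (real n)) \<longlonglongrightarrow> 0" by simp
    then show ?thesis
    proof (rule Lim_transform_eventually)
      show "\<forall>\<^sub>F n in sequentially. real n / v n * inverse (real n) = 1 / v n"
        using eventually_gt_at_top[of 0] by eventually_elim simp
    qed
  qed
  have inv_sqrt: "(\<lambda>n. t / sqrt (v n)) \<longlonglongrightarrow> 0"
    using tendsto_mult[OF tendsto_const[of t] tendsto_real_sqrt[OF inv_v]] by (simp add: real_sqrt_divide)
  have w_0: "w \<longlonglongrightarrow> 0"
    using tendsto_mult[OF tendsto_const[of \<i>] tendsto_of_real[OF inv_sqrt, where ?'a = complex]] by (simp add: w_def[abs_def])
  have w_sq: "(\<lambda>n. of_nat n * (w n)\<^sup>2) \<longlonglongrightarrow> - of_real (t\<^sup>2 / C)"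
  proof -
    have "(\<lambda>n. - complex_of_real (t\<^sup>2 * (real n / v n))) \<longlonglongrightarrow> - of_real (t\<^sup>2 * (1 / C))"
      by (intro tendsto_minus tendsto_of_real tendsto_mult tendsto_const nv)
    then have "(\<lambda>n. - complex_of_real (t\<^sup>2 * (real n / v n))) \<longlonglongrightarrow> - of_real (t\<^sup>2 / C)" by simp
    then show ?thesis
    proof (rule Lim_transform_eventually)
      show "\<forall>\<^sub>F n in sequentially. - complex_of_real (t\<^sup>2 * (real n / v n)) = of_nat n * (w n)\<^sup>2"
        using v_pos
      proof eventually_elim
        fix n assume "v n > 0"
        then have "(t / sqrt (v n))\<^sup>2 = t\<^sup>2 / v n" by (simp add: power_divide)
        then have "(w n)\<^sup>2 = - of_real (t\<^sup>2 / v n)"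
          unfolding w_def power_mult_distrib of_real_power[symmetric] by simp
        then show "- complex_of_real (t\<^sup>2 * (real n / v n)) = of_nat n * (w n)\<^sup>2" by simp
      qed
    qed
  qed

  have holF: "F holomorphic_on ball 0 r"
  proof (rule holomorphic_onI)
    fix w :: complex assume "w \<in> ball 0 r"
    from has_field_derivative_at_within[OF F_deriv[OF this]]
    show "F field_differentiable at w within ball 0 r" unfolding field_differentiable_def by (rule exI)
  qed
  obtain K \<delta> where \<delta>: "0 < \<delta>" "\<delta> < r"
    and K: "\<And>w. norm w \<le> \<delta> \<Longrightarrow> norm (F w - (F 0 + deriv F 0 * w + deriv (deriv F) 0 / 2 * w\<^sup>2)) \<le> K * norm w ^ 3"
    using second_order_Taylor[OF holF r_pos] by metis
  have w_small: "\<forall>\<^sub>F n in sequentially. norm (w n) < \<delta>"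
    using order_tendstoD(2)[OF tendsto_norm[OF w_0], of \<delta>] \<delta>(1) by simp
  \<comment> \<open>\<open>n\<close> times the Taylor error. It is of order n |w|^3 = |n w^2| |w|, a
    bounded factor times one that tends to 0.\<close>
  define R where "R n = of_nat n * (F (w n) - (F 0 + of_real A * w n + of_real C / 2 * (w n)\<^sup>2))" for n
  have R_0: "R \<longlonglongrightarrow> 0"
  proof (rule Lim_null_comparison)
    show "\<forall>\<^sub>F n in sequentially. norm (R n) \<le> norm (of_nat n * (w n)\<^sup>2) * (K * norm (w n))"
      using w_small
    proof eventually_elim
      fix n assume "norm (w n) < \<delta>"
      then have "norm (R n) \<le> real n * (K * norm (w n) ^ 3)"
        unfolding R_def norm_mult norm_of_nat using K[of "w n"] by (intro mult_left_mono) (auto simp: F1 F2)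
      then show "norm (R n) \<le> norm (of_nat n * (w n)\<^sup>2) * (K * norm (w n))"
        by (simp add: norm_mult norm_power power2_eq_square power3_eq_cube mult_ac)
    qed
    have "(\<lambda>n. norm (of_nat n * (w n)\<^sup>2) * (K * norm (w n))) \<longlonglongrightarrow> norm (- complex_of_real (t\<^sup>2 / C)) * (K * norm (0::complex))"
      by (intro tendsto_intros w_sq w_0)
    then show "(\<lambda>n. norm (of_nat n * (w n)\<^sup>2) * (K * norm (w n))) \<longlonglongrightarrow> 0" by simp
  qed
  \<comment> \<open>This expression equals n (F w - F 0) - mean w; the part of the mean that grows
    with \<open>n\<close> has absorbed the linear Taylor term.\<close>
  have "(\<lambda>n. R n - of_real (Y_mean n - A * real n) * w n + of_real C / 2 * (of_nat n * (w n)\<^sup>2))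
    \<longlonglongrightarrow> 0 - of_real (amplitude_logderiv plastic) * 0 + of_real C / 2 * (- of_real (t\<^sup>2 / C))"
    by (intro tendsto_intros R_0 mean w_0 w_sq)
  also have "0 - of_real (amplitude_logderiv plastic) * 0 + of_real C / 2 * (- of_real (t\<^sup>2 / C))
      = complex_of_real (- (t\<^sup>2) / 2)" using C by simp
  finally have "(\<lambda>n. exp (R n - of_real (Y_mean n - A * real n) * w n + of_real C / 2 * (of_nat n * (w n)\<^sup>2)))
    \<longlonglongrightarrow> exp (complex_of_real (- (t\<^sup>2) / 2))" by (rule tendsto_exp)
  \<comment> \<open>The argument moves with \<open>n\<close>, so the estimate uniform in
    \<open>w\<close> is used together with continuity of \<open>Tlim\<close> at 0.\<close>
  moreover have T_w: "(\<lambda>n. T n (w n)) \<longlonglongrightarrow> Tlim 0"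
  proof -
    have "(\<lambda>n. T n (w n) - Tlim (w n)) \<longlonglongrightarrow> 0"
    proof (rule Lim_null_comparison)
      show "\<forall>\<^sub>F n in sequentially. norm (T n (w n) - Tlim (w n)) \<le> 3000 * 0.999 ^ n"
        using w_small eventually_ge_at_top[of 2]
      proof eventually_elim
        fix n :: nat assume "norm (w n) < \<delta>" "2 \<le> n"
        then show "norm (T n (w n) - Tlim (w n)) \<le> 3000 * 0.999 ^ n"
          using \<delta> by (intro T_Tlim_bound) auto
      qed
      have "(\<lambda>n. 3000 * 0.999 ^ n) \<longlonglongrightarrow> 3000 * (0::real)"
        by (intro tendsto_mult tendsto_const LIMSEQ_realpow_zero) auto
      then show "(\<lambda>n. 3000 * 0.999 ^ n :: real) \<longlonglongrightarrow> 0" by simp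
    qed
    moreover have "isCont Tlim 0" using Tlim_deriv[OF zero_in_ball] by (rule DERIV_isCont)
    then have "(\<lambda>n. Tlim (w n)) \<longlonglongrightarrow> Tlim 0" using w_0 by (rule isCont_tendsto_compose)
    ultimately have "(\<lambda>n. T n (w n) - Tlim (w n) + Tlim (w n)) \<longlonglongrightarrow> 0 + Tlim 0" by (rule tendsto_add)
    then show ?thesis by simp
  qed
  ultimately have "(\<lambda>n. exp (R n - of_real (Y_mean n - A * real n) * w n + of_real C / 2 * (of_nat n * (w n)\<^sup>2))
      * (T n (w n) / T n 0)) \<longlonglongrightarrow> exp (complex_of_real (- (t\<^sup>2) / 2)) * (Tlim 0 / Tlim 0)"
    by (intro tendsto_mult tendsto_divide T_0_tendsto Tlim_0_nonzero)
  then have "(\<lambda>n. exp (R n - of_real (Y_mean n - A * real n) * w n + of_real C / 2 * (of_nat n * (w n)\<^sup>2))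
      * (T n (w n) / T n 0)) \<longlonglongrightarrow> of_real (exp (- (t\<^sup>2) / 2))"
    using Tlim_0_nonzero by (simp only: divide_self mult_1_right exp_of_real not_False_eq_True)
  then show ?thesis
  proof (rule Lim_transform_eventually)
    show "\<forall>\<^sub>F n in sequentially. exp (R n - of_real (Y_mean n - A * real n) * w n + of_real C / 2 * (of_nat n * (w n)\<^sup>2))
      * (T n (w n) / T n 0)
      = char (distr (measure_pmf (map_pmf (\<lambda>y. (y - Y_mean n) / sqrt (Y_var n)) (Y_dist n))) borel (\<lambda>x. x)) t"
      using w_small
    proof eventually_elim
      fix n assume "norm (w n) < \<delta>"
      then have wn: "w n \<in> ball 0 r" using \<delta> by simp
      have "summand_poly n (exp (w n)) / summand_poly n 1
          = exp (of_nat n * F (w n)) * T n (w n) / (exp (of_nat n * F 0) * T n 0)"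
        using summand_poly_exp[OF wn, of n] summand_poly_exp[OF zero_in_ball, of n] by simp
      also have "\<dots> = exp (of_nat n * F (w n) - of_nat n * F 0) * (T n (w n) / T n 0)"
        by (simp add: exp_diff)
      finally have "exp (- (of_real (Y_mean n) * w n)) * (summand_poly n (exp (w n)) / summand_poly n 1)
         = exp (- (of_real (Y_mean n) * w n) + (of_nat n * F (w n) - of_nat n * F 0)) * (T n (w n) / T n 0)"
        by (simp only: exp_add mult.assoc)
      also have "- (of_real (Y_mean n) * w n) + (of_nat n * F (w n) - of_nat n * F 0)
        = R n - of_real (Y_mean n - A * real n) * w n + of_real C / 2 * (of_nat n * (w n)\<^sup>2)"
        by (simp add: R_def algebra_simps)
      finally show "exp (R n - of_real (Y_mean n - A * real n) * w n + of_real C / 2 * (of_nat n * (w n)\<^sup>2))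
          * (T n (w n) / T n 0)
          = char (distr (measure_pmf (map_pmf (\<lambda>y. (y - Y_mean n) / sqrt (Y_var n)) (Y_dist n))) borel (\<lambda>x. x)) t"
        unfolding char_standardized w_def v_def by simp
    qed
  qed
qed

end

text \<open>Levy's theorem is about Borel distributions while a pmf carries the discrete
  sigma-algebra. Passing to the Borel sets leaves the distribution function unchanged, and weak
  convergence refers only to that.\<close>

lemma weak_conv_m_pmf:
  fixes p :: "nat \<Rightarrow> real pmf"
  assumes "real_distribution M"
    "\<And>t. (\<lambda>n. char (distr (measure_pmf (p n)) borel (\<lambda>x. x)) t) \<longlonglongrightarrow> char M t"
  shows "weak_conv_m (\<lambda>n. measure_pmf (p n)) M"
proof -
  have "weak_conv_m (\<lambda>n. distr (measure_pmf (p n)) borel (\<lambda>x. x)) M"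
    by (rule levy_continuity[OF _ assms]) (auto intro!: prob_space.real_distribution_distr prob_space_measure_pmf)
  moreover have "cdf (distr (measure_pmf (p n)) borel (\<lambda>x. x)) = cdf (measure_pmf (p n))" for n
    by (simp add: cdf_def fun_eq_iff measure_distr)
  ultimately show ?thesis by (simp add: weak_conv_m_def)
qed

theorem theorem1p14:
  shows "\<exists>A B C D :: real. 0 < A \<and> 0 < B \<and> 0 < C \<and> 0 < D \<and>
     (\<lambda>n. Y_mean n - (A * real n + B)) \<longlonglongrightarrow> 0 \<and>
     (\<lambda>n. Y_var n - (C * real n + D)) \<longlonglongrightarrow> 0 \<and>
     weak_conv_m (\<lambda>n. measure_pmf (map_pmf (\<lambda>y. (y - Y_mean n) / sqrt (Y_var n)) (Y_dist n)))
                 std_normal_distribution"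
proof -
  obtain r l where "greedy_branch r l"
  proof (rule exists_branch)
    fix r l assume "0 < r" "l holomorphic_on ball 0 r" "l 0 = complex_of_real plastic"
      "\<And>w. w \<in> ball 0 r \<Longrightarrow> l w ^ 5 - l w ^ 4 = exp w" "\<And>w. w \<in> ball 0 r \<Longrightarrow> l w \<in> branch_region"
    then have "greedy_branch r l" by unfold_locales
    then show thesis by (rule that)
  qed
  then interpret greedy_branch r l .
  have "weak_conv_m (\<lambda>n. measure_pmf (map_pmf (\<lambda>y. (y - Y_mean n) / sqrt (Y_var n)) (Y_dist n)))
                 std_normal_distribution"
    by (rule weak_conv_m_pmf[OF real_dist_normal_dist])
      (simp only: char_std_normal_distribution char_standardized_tendsto)
  moreover have "0 < (plastic - 1) / (5 * plastic - 4)" "0 < plastic * (plastic - 1) / (5 * plastic - 4) ^ 3"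
    using plastic by (auto intro!: divide_pos_pos mult_pos_pos)
  ultimately show ?thesis
    using Y_mean_asymp Y_var_asymp amplitude_logderiv_plastic_pos amplitude_logderiv2_plastic_pos
    by (intro exI conjI)
qed

end
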